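(* Let $\varpi:\mathbb{R}^3\to\mathbb{R}_+$ be measurable and $r\in[1,2]$. (1) For any $0\le f\in L^1_2(\mathbb{R}^3)\cap L\log L(\mathbb{R}^3)\setminus\{0\}$, assuming that the norms below are finite, $$\left\|(f-M^f)\,\varpi\right\|_{L^r}^2\le 2\,\max\left(\left\|M^f\varpi^2\right\|_{L^{\frac r{2-r}}},\ \left\|f\,\varpi^2\right\|_{L^{\frac r{2-r}}}\right)H_0[f|M^f],$$ where $M^f$ is the Maxwellian associated with $f$. (2) For any $\varepsilon>0$ and $0\le f\in L^1_2(\mathbb{R}^3)\setminus\{0\}$ such that $1-\varepsilon f\ge0$ and $\gamma>\frac25$, assuming that the norms below are finite, $$\left\|(f-\mathcal{M}_\varepsilon^f)\,\varpi\right\|_{L^r}^2\le 2\,\max\left(\left\|\mathcal{M}_\varepsilon^f\varpi^2\right\|_{L^{\frac r{2-r}}},\ \left\|f\,\varpi^2\right\|_{L^{\frac r{2-r}}}\right)H_\varepsilon[f|\mathcal{M}_\varepsilon^f],$$ where $\mathcal{M}_\varepsilon^f$ is the $\varepsilon$-Fermi-Dirac distribution associated with $f$. When $r=2$, $L^{\frac r{2-r}}$ is understood as $L^\infty$.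
   Context: $L^1_2(\mathbb{R}^3)$: measurable $g$ with $\int|g|(1+|v|^2)\,dv<\infty$. $L\log L(\mathbb{R}^3)$: measurable $g$ with $g\log|g|$ integrable ($0\log0=0$). Moments: for nonnegative $f\in L^1_2(\mathbb{R}^3)\setminus\{0\}$, $(\rho,u,T)\in(0,\infty)\times\mathbb{R}^3\times(0,\infty)$ are defined by $\int f\,dv=\rho$, $\int f v\,dv=\rho u$, $\int f|v|^2\,dv=3\rho T+\rho|u|^2$. For $\varepsilon>0$: $T_F(\rho,\varepsilon)=\frac12\left(\frac{3\varepsilon\rho}{4\pi}\right)^{2/3}$ and $\gamma=T/T_F(\rho,\varepsilon)$. Equilibria: for $\varepsilon\ge0$, an $\varepsilon$-Fermi-Dirac distribution (Maxwellian if $\varepsilon=0$) is a function $v\mapsto \frac{e^{a+b|v-\bar u|^2}}{1+\varepsilon e^{a+b|v-\bar u|^2}}$ with $a\in\mathbb{R}$, $\bar u\in\mathbb{R}^3$, $b<0$. $\mathcal{M}_\varepsilon^f$ denotes the unique $\varepsilon$-Fermi-Dirac distribution having the same integrals against $1$, $v$, $|v|^2$ as $f$ (known to exist for $\varepsilon>0$ when $1-\varepsilon f\ge0$ and $\gamma>\frac25$). $M^f:=\mathcal{M}_0^f$. Entropy: $\varphi_\varepsilon(x)=\frac{x}{1-\varepsilon x}$, $\Phi_\varepsilon(x)=\int_0^x\log\varphi_\varepsilon(y)\,dy$ for $x\ge0$ with $1-\varepsilon x\ge0$ (so $\Phi_0(x)=x\log x-x$); $H_\varepsilon(f)=\int_{\mathbb{R}^3}\Phi_\varepsilon(f)\,dv$;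 $H_\varepsilon[f|g]=H_\varepsilon(f)-H_\varepsilon(g)$. *)

theory Defs
  imports "HOL-Analysis.Analysis" "HOL-Probability.Essential_Supremum"
begin

text \<open>Functions on velocity space are representatives of almost-everywhere classes with respect
  to Lebesgue measure (not only its Borel restriction).\<close>

type_synonym velocity = "real ^ 3"

definition L1_2 :: "(velocity \<Rightarrow> real) set" where
  "L1_2 = {g. g \<in> borel_measurable lebesgue \<and>
              integrable lebesgue (\<lambda>v. \<bar>g v\<bar> * (1 + (norm v)\<^sup>2))}"

definition LlogL :: "(velocity \<Rightarrow> real) set" where
  "LlogL = {g. g \<in> borel_measurable lebesgue \<and> integrable lebesgue (\<lambda>v. g v * ln \<bar>g v\<bar>)}"

definition in_Lp :: "ennreal \<Rightarrow> (velocity \<Rightarrow> real) \<Rightarrow> bool" where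
  "in_Lp p g \<longleftrightarrow> g \<in> borel_measurable lebesgue \<and>
     (if p = \<infinity> then esssup lebesgue (\<lambda>v. ereal \<bar>g v\<bar>) < \<infinity>
      else integrable lebesgue (\<lambda>v. \<bar>g v\<bar> powr enn2real p))"

text \<open>The real-valued norm is meaningful only under \<open>in_Lp p g\<close>.\<close>

definition Lp_norm :: "ennreal \<Rightarrow> (velocity \<Rightarrow> real) \<Rightarrow> real" where
  "Lp_norm p g =
     (if p = \<infinity> then real_of_ereal (esssup lebesgue (\<lambda>v. ereal \<bar>g v\<bar>))
      else (LINT v|lebesgue. \<bar>g v\<bar> powr enn2real p) powr (1 / enn2real p))"

definition weight_exponent :: "real \<Rightarrow> ennreal" where
  "weight_exponent r = (if r = 2 then \<infinity> else ennreal (r / (2 - r)))"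

text \<open>Mass, bulk velocity and temperature are the solution of
  \<open>\<integral>f = \<rho>\<close>, \<open>\<integral>f v = \<rho> u\<close> and \<open>\<integral>f |v|\<^sup>2 = 3 \<rho> T + \<rho> |u|\<^sup>2\<close>.\<close>

definition mass :: "(velocity \<Rightarrow> real) \<Rightarrow> real" where
  "mass f = (LINT v|lebesgue. f v)"

definition bulk_velocity :: "(velocity \<Rightarrow> real) \<Rightarrow> velocity" where
  "bulk_velocity f = (LINT v|lebesgue. f v *\<^sub>R v) /\<^sub>R mass f"

definition temperature :: "(velocity \<Rightarrow> real) \<Rightarrow> real" where
  "temperature f =
     ((LINT v|lebesgue. f v * (norm v)\<^sup>2) - mass f * (norm (bulk_velocity f))\<^sup>2) / (3 * mass f)"

definition fermi_temperature :: "real \<Rightarrow> real \<Rightarrow> real" where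
  "fermi_temperature \<rho> \<epsilon> = (1 / 2) * (3 * \<epsilon> * \<rho> / (4 * pi)) powr (2 / 3)"

definition temperature_ratio :: "real \<Rightarrow> (velocity \<Rightarrow> real) \<Rightarrow> real" where
  "temperature_ratio \<epsilon> f = temperature f / fermi_temperature (mass f) \<epsilon>"

definition fermi_dirac :: "real \<Rightarrow> (velocity \<Rightarrow> real) set" where
  "fermi_dirac \<epsilon> =
     {\<lambda>v. exp (a + b * (norm (v - u))\<^sup>2) / (1 + \<epsilon> * exp (a + b * (norm (v - u))\<^sup>2)) | a u b. b < 0}"

text \<open>Members of \<open>fermi_dirac \<epsilon>\<close> with \<open>\<epsilon> \<ge> 0\<close> have Gaussian decay, so all their integrals below
  converge and no integrability clause is needed in the description.\<close>

definition equilibrium :: "real \<Rightarrow> (velocity \<Rightarrow> real) \<Rightarrow> velocity \<Rightarrow> real" where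
  "equilibrium \<epsilon> f = (THE M. M \<in> fermi_dirac \<epsilon> \<and>
     (LINT v|lebesgue. M v) = (LINT v|lebesgue. f v) \<and>
     (LINT v|lebesgue. M v *\<^sub>R v) = (LINT v|lebesgue. f v *\<^sub>R v) \<and>
     (LINT v|lebesgue. M v * (norm v)\<^sup>2) = (LINT v|lebesgue. f v * (norm v)\<^sup>2))"

abbreviation maxwellian :: "(velocity \<Rightarrow> real) \<Rightarrow> velocity \<Rightarrow> real" where
  "maxwellian \<equiv> equilibrium 0"

definition phi :: "real \<Rightarrow> real \<Rightarrow> real" where
  "phi \<epsilon> x = x / (1 - \<epsilon> * x)"

text \<open>Used only for \<open>x \<ge> 0\<close> with \<open>1 - \<epsilon> x \<ge> 0\<close>. The integrand has at most logarithmic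
  singularities, at the end points of the interval, where its value is immaterial.\<close>

definition Phi :: "real \<Rightarrow> real \<Rightarrow> real" where
  "Phi \<epsilon> x = integral {0..x} (\<lambda>y. ln (phi \<epsilon> y))"

definition entropy :: "real \<Rightarrow> (velocity \<Rightarrow> real) \<Rightarrow> real" where
  "entropy \<epsilon> f = (LINT v|lebesgue. Phi \<epsilon> (f v))"

definition relative_entropy ::
    "real \<Rightarrow> (velocity \<Rightarrow> real) \<Rightarrow> (velocity \<Rightarrow> real) \<Rightarrow> real" where
  "relative_entropy \<epsilon> f g = entropy \<epsilon> f - entropy \<epsilon> g"

end

theory Submission
  imports Defs "HOL-Probability.Distributions"
begin

text \<open>
  A weighted Csiszar--Kullback--Pinsker inequality. Let \<open>M\<close> be the equilibrium with the moments of
  \<open>f\<close>. Since \<open>ln (phi \<epsilon> (M v))\<close>, the derivative of the entropy density at \<open>M v\<close>, equals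
  \<open>a - (norm (v - u))\<^sup>2 / s\<^sup>2\<close>, equality of the moments makes its integral against \<open>f - M\<close> vanish
  (\<open>fermi_dirac_orthogonal\<close>). Hence the relative entropy is
  the integral of the Bregman distance of \<open>Phi \<epsilon>\<close> between \<open>f\<close> and \<open>M\<close>
  (\<open>relative_entropy_eq_bregman\<close>).

  Passing from \<open>\<epsilon> = 0\<close> to \<open>\<epsilon> > 0\<close> adds a convex function to the entropy density, so this distance is at
  least the classical one, \<open>kl x m = x * ln (x / m) - x + m\<close>, for which
  \<open>(x - m)\<^sup>2 \<le> (2/3 * x + 4/3 * m) * kl x m\<close>. A Taylor expansion with integral remainder would give a
  denominator \<open>m + \<sigma> * (x - m)\<close> averaged over \<open>\<sigma>\<close> with weight \<open>1 - \<sigma>\<close>; the weights \<open>2/3\<close> and \<open>4/3\<close>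
  are the explicit pointwise substitute. They add up to \<open>2\<close>, which is the constant of the theorem: the
  inequality of Hoelder with exponents \<open>2/r\<close> and \<open>2/(2 - r)\<close> separates the Bregman distance from the
  weighted mean of \<open>f * w\<^sup>2\<close> and \<open>M * w\<^sup>2\<close>, and convexity of the power bounds the norm of that mean
  (\<open>weighted_Lp_bound\<close>).

  It remains to see that \<open>equilibrium\<close> describes a function at all. Uniqueness comes from the same
  orthogonality: two equilibria with equal moments have symmetrised relative entropy zero, and its
  density is strictly positive where they differ (\<open>fermi_dirac_unique\<close>). For existence, translation and
  dilation leave one scale invariant quantity, \<open>mass ^ 5 / energy ^ 3\<close>, to be matched by the degeneracy
  parameter \<open>a\<close>. It depends continuously on \<open>a\<close> and is small in the dilute limit. As \<open>a\<close> grows it is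
  unbounded for \<open>\<epsilon> = 0\<close>, while for \<open>\<epsilon> > 0\<close> it tends to its value for a ball filled with density \<open>1 / \<epsilon>\<close>. The condition
  \<open>temperature_ratio \<epsilon> f > 2 / 5\<close> says that the quantity of \<open>f\<close> lies below that value, and the intermediate value
  theorem applies (\<open>fd_ratio_attained\<close>, \<open>fermi_dirac_exists\<close>).
\<close>

section \<open>The entropy density and its Bregman distance\<close>

text \<open>The antiderivative of \<open>\<lambda>y. ln (phi \<epsilon> y)\<close> that vanishes at \<open>0\<close>. The term \<open>- x\<close> is the limit of the
  other alternative as \<open>\<epsilon>\<close> tends to \<open>0\<close>.\<close>

definition Phi_closed :: "real \<Rightarrow> real \<Rightarrow> real" where
  "Phi_closed \<epsilon> x = x * ln x + (if \<epsilon> = 0 then - x else (1 - \<epsilon> * x) * ln (1 - \<epsilon> * x) / \<epsilon>)"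

text \<open>Continuity at \<open>0\<close> is what makes the closed form valid up to the end points of its domain; on the
  negative axis it follows from \<open>ln (- x) = ln x\<close>.\<close>

lemma isCont_times_ln: "isCont (\<lambda>x::real. x * ln x) x"
proof (cases "x = 0")
  case True
  have "((\<lambda>x::real. x * ln x) \<longlongrightarrow> 0) (at_right 0)" by real_asymp
  moreover have "((\<lambda>x::real. x * ln x) \<longlongrightarrow> 0) (at_left 0)"
  proof -
    have "((\<lambda>x::real. - (x * ln x)) \<longlongrightarrow> -0) (at_right 0)"
      by (rule tendsto_minus) real_asymp
    then show ?thesis
      by (subst filterlim_at_left_to_right) (simp add: ln_minus)
  qed
  ultimately show ?thesis using True by (simp add: isCont_def filterlim_split_at)
qed (auto intro!: continuous_intros)

lemma continuous_on_times_ln [continuous_intros]: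
  fixes f :: "'a::topological_space \<Rightarrow> real"
  assumes "continuous_on S f" shows "continuous_on S (\<lambda>x. f x * ln (f x))"
proof -
  have "continuous_on UNIV (\<lambda>x::real. x * ln x)"
    by (intro continuous_at_imp_continuous_on ballI isCont_times_ln)
  from continuous_on_compose2[OF this assms] show ?thesis by simp
qed

lemma borel_measurable_Phi_closed [measurable]: "Phi_closed \<epsilon> \<in> borel_measurable borel"
  unfolding Phi_closed_def by measurable

lemma Phi_eq_closed:
  assumes "0 \<le> \<epsilon>" "0 \<le> x" "0 \<le> 1 - \<epsilon> * x"
  shows "Phi \<epsilon> x = Phi_closed \<epsilon> x"
proof -
  have "((\<lambda>y. ln (phi \<epsilon> y)) has_integral (Phi_closed \<epsilon> x - Phi_closed \<epsilon> 0)) {0..x}"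
  proof (rule fundamental_theorem_of_calculus_interior)
    show "continuous_on {0..x} (Phi_closed \<epsilon>)"
    proof (cases "\<epsilon> = 0")
      case True
      have "continuous_on {0..x} (\<lambda>x. x * ln x + - x)"
        by (intro continuous_on_add continuous_on_times_ln continuous_intros)
      with True show ?thesis by (simp add: Phi_closed_def[abs_def])
    next
      case False
      have "continuous_on {0..x} (\<lambda>x. x * ln x + (1 - \<epsilon> * x) * ln (1 - \<epsilon> * x) / \<epsilon>)"
        using False
        by (intro continuous_on_add continuous_on_divide continuous_on_times_ln)
           (auto intro!: continuous_intros)
      with False show ?thesis by (simp add: Phi_closed_def[abs_def])
    qed
    fix y assume y: "y \<in> {0<..<x}"
    have pos: "0 < 1 - \<epsilon> * y"
    proof (cases "\<epsilon> = 0")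
      case False
      then have "\<epsilon> * y < \<epsilon> * x" using y assms by simp
      then show ?thesis using assms by simp
    qed simp
    have "(Phi_closed \<epsilon> has_real_derivative ln (phi \<epsilon> y)) (at y)"
    proof (cases "\<epsilon> = 0")
      case True
      then show ?thesis using y unfolding Phi_closed_def phi_def
        by (auto intro!: derivative_eq_intros)
    next
      case False
      have xlnx: "((\<lambda>x. x * ln x) has_real_derivative ln z + 1) (at z)" if "0 < z" for z :: real
        using that by (auto intro!: derivative_eq_intros)
      have "((\<lambda>x. (1 - \<epsilon> * x) * ln (1 - \<epsilon> * x)) has_real_derivative
              (ln (1 - \<epsilon> * y) + 1) * (- \<epsilon>)) (at y)"
        by (rule DERIV_chain2[where f = "\<lambda>x. x * ln x" and g = "\<lambda>x. 1 - \<epsilon> * x", OF xlnx[OF pos]])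
           (auto intro!: derivative_eq_intros)
      from DERIV_add[OF xlnx[of y] DERIV_cdivide[OF this, of \<epsilon>]] show ?thesis
        using y pos False by (simp add: Phi_closed_def[abs_def] phi_def ln_div)
    qed
    then show "(Phi_closed \<epsilon> has_vector_derivative ln (phi \<epsilon> y)) (at y)"
      by (simp add: has_real_derivative_iff_has_vector_derivative)
  qed (use assms in simp)
  then show ?thesis by (simp add: Phi_def Phi_closed_def integral_unique)
qed

text \<open>The Bregman distance of \<open>\<lambda>x. x * ln x\<close>, with the logarithm of the quotient split so that \<open>x = 0\<close> is
  covered.\<close>

definition kl :: "real \<Rightarrow> real \<Rightarrow> real" where
  "kl x m = x * ln x - x * ln m - x + m"

text \<open>The difference \<open>h\<close> of \<open>x * ln x - x + 1\<close> and \<open>3 * (x - 1)\<^sup>2 / (2 * x + 4)\<close> vanishes to first order at \<open>1\<close>, and it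
  is convex because its second derivative is \<open>1 / x - 27 / (x + 2) ^ 3\<close> while
  \<open>(x + 2) ^ 3 - 27 * x = (x - 1)\<^sup>2 * (x + 8)\<close>.\<close>

lemma kl_quadratic_at_one:
  fixes x :: real assumes "0 \<le> x"
  shows "3 * (x - 1)\<^sup>2 \<le> (2 * x + 4) * (x * ln x - x + 1)"
proof (cases "x = 0")
  case False
  with assms have x: "0 < x" by simp
  define h where "h = (\<lambda>x::real. x * ln x - x + 1 - 3 * (x - 1)\<^sup>2 / (2 * x + 4))"
  define h' where "h' = (\<lambda>x::real. ln x - 3 * (x - 1) * (x + 5) / (2 * (x + 2)\<^sup>2))"
  define h'' where "h'' = (\<lambda>x::real. 1 / x - 27 / (x + 2) ^ 3)"
  have d1: "(h has_real_derivative h' y) (at y)" if "y \<in> {0<..}" for y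
    unfolding h_def h'_def using that
    apply (auto intro!: derivative_eq_intros)
    apply (simp add: divide_simps)
    apply algebra
    done
  have d2: "(h' has_real_derivative h'' y) (at y)" if "y \<in> {0<..}" for y
    unfolding h'_def h''_def using that
    apply (auto intro!: derivative_eq_intros)
    apply (simp add: divide_simps)
    apply algebra
    done
  have d3: "0 \<le> h'' y" if "y \<in> {0<..}" for y
  proof -
    have "(y + 2) ^ 3 - 27 * y = (y - 1)\<^sup>2 * (y + 8)" by algebra
    moreover have "0 \<le> (y - 1)\<^sup>2 * (y + 8)" using that by simp
    ultimately show ?thesis using that unfolding h''_def by (simp add: divide_simps)
  qed
  have "convex_on {0<..} h"
    by (rule f''_ge0_imp_convex[OF _ d1 d2 d3]) auto
  moreover have "(h has_real_derivative 0) (at 1 within {0<..})"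
    using d1[of 1] by (auto simp: h'_def intro: has_field_derivative_at_within)
  ultimately have "h x - h 1 \<ge> 0 * (x - 1)"
    by (intro convex_on_imp_above_tangent[where A = "{0<..}"]) (use x in \<open>auto simp: interior_open\<close>)
  then show ?thesis using x by (simp add: h_def field_simps)
qed simp

lemma kl_quadratic:
  assumes "0 \<le> x" "0 < m"
  shows "(x - m)\<^sup>2 \<le> (2/3 * x + 4/3 * m) * kl x m"
proof -
  have "3 * (x/m - 1)\<^sup>2 \<le> (2 * (x/m) + 4) * (x/m * ln (x/m) - x/m + 1)"
    by (rule kl_quadratic_at_one) (use assms in simp)
  then have "m\<^sup>2 * (3 * (x/m - 1)\<^sup>2) \<le> m\<^sup>2 * ((2 * (x/m) + 4) * (x/m * ln (x/m) - x/m + 1))"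
    by (rule mult_left_mono) simp
  then have "3 * (m * (x/m - 1))\<^sup>2 \<le> (m * (2 * (x/m) + 4)) * (m * (x/m * ln (x/m) - x/m + 1))"
    by (simp only: power2_eq_square ac_simps)
  moreover have "m * (x/m - 1) = x - m" "m * (2 * (x/m) + 4) = 2 * x + 4 * m"
    using assms by (auto simp: field_simps)
  moreover have "m * (x/m * ln (x/m) - x/m + 1) = kl x m"
    using assms by (cases "x = 0") (auto simp: kl_def ln_div field_simps)
  ultimately have "3 * (x - m)\<^sup>2 \<le> (2 * x + 4 * m) * kl x m" by simp
  then show ?thesis by (simp add: algebra_simps)
qed

lemma kl_nonneg:
  assumes "0 \<le> x" "0 < m" shows "0 \<le> kl x m"
proof -
  have "0 \<le> (2/3 * x + 4/3 * m) * kl x m"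
    using order_trans[OF zero_le_power2 kl_quadratic[OF assms]] .
  moreover have "0 < 2/3 * x + 4/3 * m" using assms by simp
  ultimately show ?thesis by (simp add: zero_le_mult_iff)
qed

definition bregman :: "real \<Rightarrow> real \<Rightarrow> real \<Rightarrow> real" where
  "bregman \<epsilon> x m = Phi_closed \<epsilon> x - Phi_closed \<epsilon> m - ln (phi \<epsilon> m) * (x - m)"

text \<open>The summand of \<open>Phi_closed \<epsilon>\<close> depending on \<open>1 - \<epsilon> * x\<close> contributes the distance
  \<open>kl (1 - \<epsilon> * x) (1 - \<epsilon> * m) / \<epsilon>\<close> between the densities of holes, which is nonnegative.\<close>

lemma kl_le_bregman:
  assumes "0 \<le> \<epsilon>" "0 \<le> x" "0 \<le> 1 - \<epsilon> * x" "0 < m" "0 < 1 - \<epsilon> * m"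
  shows "kl x m \<le> bregman \<epsilon> x m"
proof (cases "\<epsilon> = 0")
  case True
  then show ?thesis using assms by (simp add: bregman_def kl_def Phi_closed_def phi_def algebra_simps)
next
  case False
  have "bregman \<epsilon> x m = kl x m + kl (1 - \<epsilon> * x) (1 - \<epsilon> * m) / \<epsilon>"
    using assms False by (simp add: bregman_def kl_def Phi_closed_def phi_def ln_div field_simps)
  with kl_nonneg[of "1 - \<epsilon> * x" "1 - \<epsilon> * m"] assms show ?thesis by simp
qed

lemma quadratic_le_bregman:
  assumes "0 \<le> \<epsilon>" "0 \<le> x" "0 \<le> 1 - \<epsilon> * x" "0 < m" "\<epsilon> * m < 1"
  shows "0 \<le> bregman \<epsilon> x m" "(x - m)\<^sup>2 \<le> (2/3 * x + 4/3 * m) * bregman \<epsilon> x m"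
proof -
  have le: "kl x m \<le> bregman \<epsilon> x m" using assms by (intro kl_le_bregman) auto
  then show "0 \<le> bregman \<epsilon> x m" using kl_nonneg[of x m] assms by simp
  have "(x - m)\<^sup>2 \<le> (2/3 * x + 4/3 * m) * kl x m" using assms by (intro kl_quadratic) auto
  also have "\<dots> \<le> (2/3 * x + 4/3 * m) * bregman \<epsilon> x m" using le assms by (intro mult_left_mono) auto
  finally show "(x - m)\<^sup>2 \<le> (2/3 * x + 4/3 * m) * bregman \<epsilon> x m" .
qed

text \<open>Nonnegativity of \<open>kl x (exp (- q))\<close> is a lower bound for \<open>x * ln x\<close> in terms of an arbitrary \<open>q\<close>. With
  \<open>q = (norm v)\<^sup>2\<close> it controls the entropy of a small density by its energy.\<close>

lemma abs_entropy_le: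
  fixes x q :: real
  assumes "0 \<le> x" "x \<le> 1"
  shows "\<bar>x * ln x\<bar> \<le> x * q + exp (- q)"
proof -
  have "x * ln x \<le> 0"
    using assms by (cases "x = 0") (auto intro: mult_nonneg_nonpos)
  moreover have "0 \<le> kl x (exp (- q))" using assms by (intro kl_nonneg) auto
  ultimately show ?thesis using assms by (auto simp: kl_def)
qed

text \<open>For \<open>0 \<le> z \<le> 1\<close>, nonnegativity of \<open>kl z 1\<close> gives \<open>\<bar>z * ln z\<bar> \<le> 1 - z\<close>; here \<open>z = 1 - \<epsilon> * x\<close>.\<close>

lemma abs_Phi_closed_le:
  assumes "0 \<le> \<epsilon>" "0 \<le> x" "0 \<le> 1 - \<epsilon> * x"
  shows "\<bar>Phi_closed \<epsilon> x\<bar> \<le> \<bar>x * ln x\<bar> + x"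
proof (cases "\<epsilon> = 0")
  case False
  have "\<bar>(1 - \<epsilon> * x) * ln (1 - \<epsilon> * x)\<bar> \<le> 1 - (1 - \<epsilon> * x)"
  proof -
    have "(1 - \<epsilon> * x) * ln (1 - \<epsilon> * x) \<le> 0"
      using assms by (cases "1 - \<epsilon> * x = 0") (auto intro!: mult_nonneg_nonpos)
    moreover have "0 \<le> kl (1 - \<epsilon> * x) 1" using assms by (intro kl_nonneg) auto
    ultimately show ?thesis by (simp add: kl_def)
  qed
  then have "\<bar>(1 - \<epsilon> * x) * ln (1 - \<epsilon> * x) / \<epsilon>\<bar> \<le> x"
    using assms False by (simp add: abs_div field_simps)
  moreover have "\<bar>Phi_closed \<epsilon> x\<bar> \<le> \<bar>x * ln x\<bar> + \<bar>(1 - \<epsilon> * x) * ln (1 - \<epsilon> * x) / \<epsilon>\<bar>"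
    using False unfolding Phi_closed_def by (simp only: if_False abs_triangle_ineq)
  ultimately show ?thesis by linarith
qed (use assms in \<open>simp add: Phi_closed_def\<close>)

section \<open>Lebesgue measure: affine maps, Gaussians and balls\<close>

text \<open>Completeness of Lebesgue measure. The closed form of the entropy density is available only where the density
  is in its physical range, that is, almost everywhere.\<close>

lemma borel_measurable_lebesgue_AE:
  fixes f g :: "'a::euclidean_space \<Rightarrow> real"
  assumes g: "g \<in> borel_measurable lebesgue" and ae: "AE x in lebesgue. f x = g x"
  shows "f \<in> borel_measurable lebesgue"
proof (rule measurableI)
  fix A :: "real set" assume A: "A \<in> sets borel"
  show "f -` A \<inter> space lebesgue \<in> sets lebesgue"
  proof (rule completion.in_sets_AE)
    show "g -` A \<inter> space lebesgue \<in> sets lebesgue" using g A by (rule measurable_sets)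
    show "AE x in lebesgue. (x \<in> g -` A \<inter> space lebesgue) = (x \<in> f -` A \<inter> space lebesgue)"
      using ae by eventually_elim auto
  qed auto
qed simp

lemma borel_measurable_lebesgueI:
  "f \<in> borel_measurable borel \<Longrightarrow> f \<in> borel_measurable lebesgue"
  by (rule measurable_completion) simp

lemma not_AE_lebesgue_False: "\<not> (AE x::'a::euclidean_space in lebesgue. False)"
  by (simp add: completion.AE_iff_null_sets null_sets_def)

lemma AE_lebesgue_neq: "AE x in lebesgue. (x::'a::euclidean_space) \<noteq> c"
  by (rule AE_completion) (rule AE_lborel_singleton)

lemma integral_pos_AE:
  fixes g :: "'a::euclidean_space \<Rightarrow> real"
  assumes "integrable lebesgue g" "AE x in lebesgue. 0 < g x"
  shows "0 < (LINT x|lebesgue. g x)"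
proof -
  have nn: "AE x in lebesgue. 0 \<le> g x" using assms(2) by eventually_elim simp
  have "(LINT x|lebesgue. g x) \<noteq> 0"
  proof
    assume "(LINT x|lebesgue. g x) = 0"
    then have "AE x in lebesgue. g x = 0" using integral_nonneg_eq_0_iff_AE[OF assms(1) nn] by simp
    then have "AE x::'a in lebesgue. False" using assms(2) by eventually_elim simp
    then show False using not_AE_lebesgue_False by blast
  qed
  moreover have "0 \<le> (LINT x|lebesgue. g x)" using nn by (rule integral_nonneg_AE)
  ultimately show ?thesis by simp
qed

lemma continuous_AE_eq_imp_eq:
  fixes g h :: "'a::euclidean_space \<Rightarrow> real"
  assumes "continuous_on UNIV g" "continuous_on UNIV h" "AE v in lebesgue. g v = h v"
  shows "g = h"
proof (rule ccontr)
  assume "g \<noteq> h"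
  have "open {v. g v \<noteq> h v}" using assms by (intro open_Collect_neq)
  moreover have "{v. g v \<noteq> h v} \<noteq> {}" using \<open>g \<noteq> h\<close> by auto
  moreover have "negligible {v. g v \<noteq> h v}"
    using assms(3) by (simp add: completion.AE_iff_null_sets negligible_iff_null_sets)
  ultimately show False using open_not_negligible by blast
qed

lemma lebesgue_integral_affine:
  fixes h :: "'a::euclidean_space \<Rightarrow> 'b::{banach, second_countable_topology}" and s :: real
  assumes h: "h \<in> borel_measurable borel" and s: "s \<noteq> 0"
  shows "(LINT v|lebesgue. h ((v - u) /\<^sub>R s)) = \<bar>s\<bar> ^ DIM('a) *\<^sub>R (LINT x|lebesgue. h x)"
    and "integrable lebesgue (\<lambda>v. h ((v - u) /\<^sub>R s)) \<longleftrightarrow> integrable lebesgue h"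
proof -
  note [measurable] = h
  have eq: "(lborel :: 'a measure) = density (distr lborel borel (\<lambda>x. u + s *\<^sub>R x)) (\<lambda>_. ennreal (\<bar>s\<bar> ^ DIM('a)))"
    using lborel_affine[of s u] s by simp
  have "(LINT v|lborel. h ((v - u) /\<^sub>R s)) =
      (LINT v|density (distr lborel borel (\<lambda>x. u + s *\<^sub>R x)) (\<lambda>_. ennreal (\<bar>s\<bar> ^ DIM('a))). h ((v - u) /\<^sub>R s))"
    by (rule arg_cong[where f = "\<lambda>M. lebesgue_integral M _", OF eq])
  also have "\<dots> = \<bar>s\<bar> ^ DIM('a) *\<^sub>R (LINT x|lborel. h x)"
    using s by (subst integral_density) (auto simp: integral_distr)
  finally show "(LINT v|lebesgue. h ((v - u) /\<^sub>R s)) = \<bar>s\<bar> ^ DIM('a) *\<^sub>R (LINT x|lebesgue. h x)"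
    by (subst (1 2) integral_completion) auto
  have "integrable lborel (\<lambda>v. h ((v - u) /\<^sub>R s)) \<longleftrightarrow>
      integrable (density (distr lborel borel (\<lambda>x. u + s *\<^sub>R x)) (\<lambda>_. ennreal (\<bar>s\<bar> ^ DIM('a)))) (\<lambda>v. h ((v - u) /\<^sub>R s))"
    by (rule arg_cong[where f = "\<lambda>M. integrable M _", OF eq])
  also have "\<dots> \<longleftrightarrow> integrable lborel (\<lambda>x. \<bar>s\<bar> ^ DIM('a) *\<^sub>R h x)"
    using s by (subst integrable_density) (auto simp: integrable_distr_eq)
  also have "\<dots> \<longleftrightarrow> integrable lborel h"
  proof
    assume "integrable lborel (\<lambda>x. \<bar>s\<bar> ^ DIM('a) *\<^sub>R h x)"
    from integrable_scaleR_right[OF this, of "1 / \<bar>s\<bar> ^ DIM('a)"] show "integrable lborel h" using s by simp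
  qed simp
  finally show "integrable lebesgue (\<lambda>v. h ((v - u) /\<^sub>R s)) \<longleftrightarrow> integrable lebesgue h"
    by (subst (1 2) integrable_completion) auto
qed

text \<open>The Gaussian is a product over the coordinates, which reduces the claim to dimension one.\<close>

lemma integrable_gaussian:
  assumes "0 < k"
  shows "integrable lebesgue (\<lambda>v::'a::euclidean_space. exp (- (k * (norm v)\<^sup>2)))"
proof -
  have one: "(\<integral>\<^sup>+(x::real). ennreal (exp (- (k * x\<^sup>2))) \<partial>lborel) < \<infinity>"
  proof -
    have "integrable lborel (\<lambda>x. sqrt (2 * pi * (1 / sqrt (2 * k))\<^sup>2) * normal_density 0 (1 / sqrt (2 * k)) x)"
      using assms by (intro integrable_mult_right integrable_normal_density) simp
    moreover have "sqrt (2 * pi * (1 / sqrt (2 * k))\<^sup>2) * normal_density 0 (1 / sqrt (2 * k)) x = exp (- (k * x\<^sup>2))" for x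
      using assms by (simp add: normal_density_def power_divide)
    ultimately have "integrable lborel (\<lambda>x. exp (- (k * x\<^sup>2)))" by simp
    then show ?thesis by (simp add: integrable_iff_bounded)
  qed
  have "exp (- (k * (norm v)\<^sup>2)) = (\<Prod>b\<in>Basis. exp (- (k * (v \<bullet> b)\<^sup>2)))" for v :: 'a
  proof -
    have "(norm v)\<^sup>2 = (\<Sum>b\<in>Basis. (v \<bullet> b)\<^sup>2)"
      by (subst power2_norm_eq_inner, subst euclidean_inner) (simp add: power2_eq_square)
    then show ?thesis by (simp add: exp_sum[symmetric] sum_distrib_left sum_negf)
  qed
  then have "(\<integral>\<^sup>+(v::'a). ennreal (exp (- (k * (norm v)\<^sup>2))) \<partial>lborel) =
      (\<integral>\<^sup>+(v::'a). (\<Prod>b\<in>Basis. ennreal (exp (- (k * (v \<bullet> b)\<^sup>2)))) \<partial>lborel)"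
    by (simp add: prod_ennreal)
  also have "\<dots> = (\<Prod>b\<in>(Basis :: 'a set). \<integral>\<^sup>+x. ennreal (exp (- (k * x\<^sup>2))) \<partial>lborel)"
    by (rule nn_integral_lborel_prod) auto
  also have "\<dots> < \<infinity>" using one by (simp add: power_less_top_ennreal)
  finally have "integrable lborel (\<lambda>v::'a. exp (- (k * (norm v)\<^sup>2)))"
    by (simp add: integrable_iff_bounded)
  then show ?thesis by (subst integrable_completion) auto
qed

lemma integrable_gaussian_norm2:
  "integrable lebesgue (\<lambda>v::'a::euclidean_space. (norm v)\<^sup>2 * exp (- (norm v)\<^sup>2))"
proof (rule Bochner_Integration.integrable_bound)
  show "integrable lebesgue (\<lambda>v::'a. 2 * exp (- (1/2 * (norm v)\<^sup>2)))"
    by (intro integrable_mult_right integrable_gaussian) simp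
  have "x * exp (- x) \<le> 2 * exp (- (1/2 * x))" if "0 \<le> x" for x :: real
  proof -
    have "x \<le> 2 * exp (x / 2)" using exp_ge_add_one_self[of "x/2"] by linarith
    then have "x * exp (- x) \<le> 2 * exp (x / 2) * exp (- x)" by (rule mult_right_mono) simp
    also have "\<dots> = 2 * exp (- (1/2 * x))" by (simp add: exp_add[symmetric] mult.assoc)
    finally show ?thesis .
  qed
  then show "AE v::'a in lebesgue. norm ((norm v)\<^sup>2 * exp (- (norm v)\<^sup>2)) \<le> norm (2 * exp (- (1/2 * (norm v)\<^sup>2)))"
    by (auto simp: abs_mult)
qed (rule borel_measurable_lebesgueI, measurable)

lemma integrable_indicator_ball:
  "integrable lebesgue (indicator (ball (c::'a::euclidean_space) r) :: 'a \<Rightarrow> real)"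
  using emeasure_lborel_ball_finite[of c r] by (simp add: integrable_indicator_iff)

lemma borel_measurable_ball_norm2:
  "(\<lambda>y::'a::euclidean_space. indicator (ball 0 r) y * (norm y)\<^sup>2 :: real) \<in> borel_measurable borel"
proof -
  have "(\<lambda>y::'a. (norm y)\<^sup>2) \<in> borel_measurable borel" by measurable
  then show ?thesis by (intro borel_measurable_times borel_measurable_indicator) auto
qed

lemma integrable_ball_norm2:
  "integrable lebesgue (\<lambda>y::'a::euclidean_space. indicator (ball 0 r) y * (norm y)\<^sup>2)"
proof (rule Bochner_Integration.integrable_bound)
  show "integrable lebesgue (\<lambda>y::'a. r\<^sup>2 * indicator (ball 0 r) y)"
    using integrable_indicator_ball by (rule integrable_mult_right)
  show "AE y::'a in lebesgue. norm (indicator (ball 0 r) y * (norm y)\<^sup>2) \<le> norm (r\<^sup>2 * indicator (ball 0 r) y)"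
    by (auto simp: indicator_def intro!: power_mono)
qed (rule borel_measurable_lebesgueI, rule borel_measurable_ball_norm2)

text \<open>The second moment \<open>J r\<close> of the ball of radius \<open>r\<close> is \<open>r ^ 5 * J 1\<close>, and its volume is \<open>V * r ^ 3\<close>. Comparing
  the two on a thin shell at the boundary and letting \<open>r\<close> tend to \<open>1\<close> gives \<open>5 * J 1 \<le> 3 * V\<close> without
  polar coordinates. This is the bound from which the constant \<open>2 / 5\<close> for the temperature ratio arises.\<close>

lemma ball_second_moment:
  "(LINT y|lebesgue. indicator (ball 0 1) y * (norm (y::velocity))\<^sup>2) \<le> 3 / 5 * (4 / 3 * pi)"
proof -
  define V where "V = 4 / 3 * pi"
  define J where "J r = (LINT y|lebesgue. indicator (ball 0 r) y * (norm (y::velocity))\<^sup>2)" for r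
  have vol: "measure lebesgue (ball (0::velocity) r) = V * r ^ 3" if "0 \<le> r" for r
    using content_ball[OF that, of "0::velocity"] by (simp add: V_def unit_ball_vol_3)
  note fin = integrable_indicator_ball[where 'a = velocity]
  have J_int: "integrable lebesgue (\<lambda>y::velocity. indicator (ball 0 r) y * (norm y)\<^sup>2)" for r
    by (rule integrable_ball_norm2)
  have J_scale: "J r = r ^ 5 * J 1" if r: "0 < r" for r
  proof -
    have "J r = (LINT v|lebesgue. r\<^sup>2 * (indicator (ball 0 1) ((v - 0) /\<^sub>R r) * (norm ((v - 0::velocity) /\<^sub>R r))\<^sup>2))"
      unfolding J_def using r
      by (intro Bochner_Integration.integral_cong refl) (auto simp: indicator_def power_divide field_simps)
    also have "\<dots> = r\<^sup>2 * (\<bar>r\<bar> ^ 3 *\<^sub>R J 1)"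
      unfolding J_def using r
      by (subst integral_mult_right_zero, subst lebesgue_integral_affine(1))
         (auto intro: borel_measurable_ball_norm2)
    finally show ?thesis using r by (simp add: power_add[symmetric] flip: mult.assoc)
  qed
  \<comment> \<open>On the shell between radii \<open>r\<close> and \<open>1\<close> the weight is at most \<open>1\<close>; by scaling, the two sides
    of the estimate are multiples of \<open>J 1\<close> and \<open>V\<close>, and \<open>1 - r\<close> cancels.\<close>
  have shell: "J 1 * (1 + r + r^2 + r^3 + r^4) \<le> V * (1 + r + r^2)" if r: "0 < r" "r < 1" for r
  proof -
    have "J 1 - J r = (LINT y|lebesgue. indicator (ball 0 1) y * (norm (y::velocity))\<^sup>2 - indicator (ball 0 r) y * (norm y)\<^sup>2)"
      unfolding J_def using J_int by simp
    also have "\<dots> \<le> (LINT y|lebesgue. indicator (ball (0::velocity) 1) y - indicator (ball 0 r) y)"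
    proof (rule integral_mono)
      fix y :: velocity
      have "(norm y)\<^sup>2 \<le> 1" if "norm y < 1" using that by (simp add: power_le_one)
      then show "indicator (ball 0 1) y * (norm y)\<^sup>2 - indicator (ball 0 r) y * (norm y)\<^sup>2 \<le> (indicator (ball 0 1) y - indicator (ball 0 r) y :: real)"
        using r by (auto simp: indicator_def)
    qed (use J_int fin in auto)
    also have "\<dots> = V - V * r ^ 3"
      using fin vol[of 1] vol[of r] r by simp
    finally have "(1 - r) * (J 1 * (1 + r + r^2 + r^3 + r^4)) \<le> (1 - r) * (V * (1 + r + r^2))"
      using J_scale[OF r(1)] by (simp add: algebra_simps power2_eq_square eval_nat_numeral)
    then show ?thesis using r by simp
  qed
  have "J 1 * (1 + 1 + 1^2 + 1^3 + 1^4) \<le> V * (1 + 1 + 1^2)"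
  proof (rule tendsto_le)
    show "((\<lambda>r. V * (1 + r + r^2)) \<longlongrightarrow> V * (1 + 1 + 1^2)) (at_left 1)"
         "((\<lambda>r. J 1 * (1 + r + r^2 + r^3 + r^4)) \<longlongrightarrow> J 1 * (1 + 1 + 1^2 + 1^3 + 1^4)) (at_left 1)"
      by (intro tendsto_intros)+
    show "\<forall>\<^sub>F r in at_left 1. J 1 * (1 + r + r^2 + r^3 + r^4) \<le> V * (1 + r + r^2)"
      using eventually_at_left_real[OF zero_less_one] by eventually_elim (use shell in auto)
  qed simp
  then show ?thesis by (simp add: J_def V_def)
qed

section \<open>Fermi-Dirac profiles\<close>

text \<open>The profile as a function of the squared distance \<open>x\<close> from the centre; \<open>a\<close> measures the degeneracy.\<close>

definition fd :: "real \<Rightarrow> real \<Rightarrow> real \<Rightarrow> real" where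
  "fd \<epsilon> a x = exp (a - x) / (1 + \<epsilon> * exp (a - x))"

lemma fd_measurable [measurable]: "fd \<epsilon> a \<in> borel_measurable borel"
  unfolding fd_def by measurable

lemma fd_bounds:
  assumes "0 \<le> \<epsilon>"
  shows "0 < fd \<epsilon> a x" "fd \<epsilon> a x \<le> exp (a - x)" "\<epsilon> * fd \<epsilon> a x < 1"
    and "0 \<le> x \<Longrightarrow> exp (a - x) / (1 + \<epsilon> * exp a) \<le> fd \<epsilon> a x"
proof -
  have d: "1 \<le> 1 + \<epsilon> * exp (a - x)" using assms by simp
  then show "0 < fd \<epsilon> a x" "fd \<epsilon> a x \<le> exp (a - x)" "\<epsilon> * fd \<epsilon> a x < 1"
    unfolding fd_def by (auto simp: divide_simps intro: add_pos_nonneg)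
  assume "0 \<le> x"
  then have "1 + \<epsilon> * exp (a - x) \<le> 1 + \<epsilon> * exp a" using assms by (simp add: mult_left_mono)
  then show "exp (a - x) / (1 + \<epsilon> * exp a) \<le> fd \<epsilon> a x"
    unfolding fd_def using d by (intro divide_left_mono) auto
qed

lemma fd_zero: "exp a * fd 0 0 x = exp (a - x)"
  by (simp add: fd_def exp_diff exp_minus field_simps)

text \<open>The function \<open>phi \<epsilon>\<close> undoes the Fermi-Dirac saturation, so that the entropy variable of an equilibrium is
  affine in the squared distance.\<close>

lemma ln_phi_fd:
  assumes "0 \<le> \<epsilon>" shows "ln (phi \<epsilon> (fd \<epsilon> a x)) = a - x"
proof -
  have "0 < 1 + \<epsilon> * exp (a - x)" using assms by (simp add: add_pos_nonneg)
  then have "phi \<epsilon> (fd \<epsilon> a x) = exp (a - x)"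
    by (simp add: phi_def fd_def field_simps)
  then show ?thesis by simp
qed

lemma norm_sq_scaled: "(norm (x /\<^sub>R s))\<^sup>2 = (norm x)\<^sup>2 / s\<^sup>2"
  by (simp add: power_mult_distrib power_inverse divide_inverse)

text \<open>Equilibria are parametrised by the length \<open>s\<close> rather than by the coefficient \<open>b = - 1 / s\<^sup>2\<close>, since all
  moments are powers of \<open>s\<close> times moments of the profile.\<close>

definition fd_state :: "real \<Rightarrow> real \<Rightarrow> velocity \<Rightarrow> real \<Rightarrow> velocity \<Rightarrow> real" where
  "fd_state \<epsilon> a u s = (\<lambda>v. fd \<epsilon> a ((norm ((v - u) /\<^sub>R s))\<^sup>2))"

lemma fermi_dirac_iff: "M \<in> fermi_dirac \<epsilon> \<longleftrightarrow> (\<exists>a u s. 0 < s \<and> M = fd_state \<epsilon> a u s)"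
proof
  assume "M \<in> fermi_dirac \<epsilon>"
  then obtain a u b where M: "M = (\<lambda>v. exp (a + b * (norm (v - u))\<^sup>2) / (1 + \<epsilon> * exp (a + b * (norm (v - u))\<^sup>2)))" "b < 0"
    unfolding fermi_dirac_def by blast
  then have "M = fd_state \<epsilon> a u (1 / sqrt (- b))"
    unfolding fd_state_def fd_def norm_sq_scaled by (simp add: power_divide mult.commute)
  then show "\<exists>a u s. 0 < s \<and> M = fd_state \<epsilon> a u s"
    using M by (intro exI[of _ a] exI[of _ u] exI[of _ "1 / sqrt (- b)"]) simp
next
  assume "\<exists>a u s. 0 < s \<and> M = fd_state \<epsilon> a u s"
  then obtain a u s where M: "0 < s" "M = fd_state \<epsilon> a u s" by blast
  then have "M = (\<lambda>v. exp (a + - (1 / s\<^sup>2) * (norm (v - u))\<^sup>2) / (1 + \<epsilon> * exp (a + - (1 / s\<^sup>2) * (norm (v - u))\<^sup>2)))"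
    by (simp add: fd_state_def fd_def norm_sq_scaled del: norm_scaleR)
  moreover have "- (1 / s\<^sup>2) < 0" using M by simp
  ultimately show "M \<in> fermi_dirac \<epsilon>" unfolding fermi_dirac_def by blast
qed

lemma fd_state_borel [measurable]: "fd_state \<epsilon> a u s \<in> borel_measurable borel"
  unfolding fd_state_def by measurable

definition fd_mass :: "real \<Rightarrow> real \<Rightarrow> real" where
  "fd_mass \<epsilon> a = (LINT w|lebesgue. fd \<epsilon> a ((norm (w::velocity))\<^sup>2))"

definition fd_energy :: "real \<Rightarrow> real \<Rightarrow> real" where
  "fd_energy \<epsilon> a = (LINT w|lebesgue. (norm (w::velocity))\<^sup>2 * fd \<epsilon> a ((norm w)\<^sup>2))"

lemma integrable_fd:
  assumes "0 \<le> \<epsilon>"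
  shows "integrable lebesgue (\<lambda>w::'a::euclidean_space. fd \<epsilon> a ((norm w)\<^sup>2))"
    and "integrable lebesgue (\<lambda>w::'a. (norm w)\<^sup>2 * fd \<epsilon> a ((norm w)\<^sup>2))"
proof -
  have b: "fd \<epsilon> a ((norm w)\<^sup>2) \<le> exp a * exp (- (norm w)\<^sup>2)" for w :: 'a
    using fd_bounds(2)[OF assms, of a "(norm w)\<^sup>2"] by (simp add: exp_diff exp_minus field_simps)
  show "integrable lebesgue (\<lambda>w::'a. fd \<epsilon> a ((norm w)\<^sup>2))"
  proof (rule Bochner_Integration.integrable_bound)
    show "integrable lebesgue (\<lambda>w::'a. exp a * exp (- (norm w)\<^sup>2))"
      using integrable_gaussian[of 1] by (intro integrable_mult_right) simp
    show "AE w::'a in lebesgue. norm (fd \<epsilon> a ((norm w)\<^sup>2)) \<le> norm (exp a * exp (- (norm w)\<^sup>2))"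
      using b fd_bounds(1)[OF assms] by (auto simp: abs_of_pos)
  qed (rule borel_measurable_lebesgueI, measurable)
  show "integrable lebesgue (\<lambda>w::'a. (norm w)\<^sup>2 * fd \<epsilon> a ((norm w)\<^sup>2))"
  proof (rule Bochner_Integration.integrable_bound)
    show "integrable lebesgue (\<lambda>w::'a. exp a * ((norm w)\<^sup>2 * exp (- (norm w)\<^sup>2)))"
      by (intro integrable_mult_right integrable_gaussian_norm2)
    show "AE w::'a in lebesgue. norm ((norm w)\<^sup>2 * fd \<epsilon> a ((norm w)\<^sup>2)) \<le> norm (exp a * ((norm w)\<^sup>2 * exp (- (norm w)\<^sup>2)))"
      using mult_left_mono[OF b zero_le_power2[of "norm _"]] fd_bounds(1)[OF assms]
      by (auto simp: abs_mult abs_of_pos ac_simps)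
  qed (rule borel_measurable_lebesgueI, measurable)
qed

lemma fd_moments_pos:
  assumes "0 \<le> \<epsilon>" shows "0 < fd_mass \<epsilon> a" "0 < fd_energy \<epsilon> a"
  unfolding fd_mass_def fd_energy_def
  using integrable_fd[OF assms] fd_bounds(1)[OF assms] AE_lebesgue_neq[of 0]
  by (auto intro!: integral_pos_AE)

text \<open>Along a convergent, hence bounded, sequence of parameters a single Gaussian dominates all profiles.\<close>

lemma isCont_fd_moments:
  assumes "0 \<le> \<epsilon>" shows "isCont (fd_mass \<epsilon>) a" "isCont (fd_energy \<epsilon>) a"
proof -
  have fd_cont: "(\<lambda>n. fd \<epsilon> (x n) y) \<longlonglongrightarrow> fd \<epsilon> a y" if "x \<longlonglongrightarrow> a" for x :: "nat \<Rightarrow> real" and y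
    unfolding fd_def using assms by (intro tendsto_intros that) (auto simp: add_nonneg_eq_0_iff)
  have bound: "\<exists>B. \<forall>n y. \<bar>fd \<epsilon> (x n) y\<bar> \<le> exp B * exp (- y)" if x: "x \<longlonglongrightarrow> a" for x :: "nat \<Rightarrow> real"
  proof -
    from convergent_imp_Bseq[OF convergentI[OF x]] obtain B where "\<And>n. \<bar>x n\<bar> \<le> B"
      by (auto simp: Bseq_def)
    then have "x n \<le> B" for n using abs_le_D1 by blast
    then have "fd \<epsilon> (x n) y \<le> exp B * exp (- y)" for n y
      using fd_bounds(2)[OF assms, of "x n" y] by (auto intro: order_trans simp: exp_add[symmetric])
    then show ?thesis using fd_bounds(1)[OF assms] by (auto simp: abs_of_pos)
  qed
  show "isCont (fd_mass \<epsilon>) a"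
    unfolding continuous_at_sequentially
  proof (intro allI impI)
    fix x assume x: "x \<longlonglongrightarrow> a"
    obtain B where B: "\<bar>fd \<epsilon> (x n) y\<bar> \<le> exp B * exp (- y)" for n y using bound[OF x] by blast
    show "(fd_mass \<epsilon> \<circ> x) \<longlonglongrightarrow> fd_mass \<epsilon> a"
      unfolding fd_mass_def o_def
    proof (rule integral_dominated_convergence[where w = "\<lambda>w. exp B * exp (- (norm w)\<^sup>2)"])
      show "integrable lebesgue (\<lambda>w::velocity. exp B * exp (- (norm w)\<^sup>2))"
        using integrable_gaussian[of 1] by (intro integrable_mult_right) simp
    qed (use B fd_cont[OF x] borel_measurable_integrable[OF integrable_fd(1)[OF assms]] in auto)
  qed
  show "isCont (fd_energy \<epsilon>) a"
    unfolding continuous_at_sequentially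
  proof (intro allI impI)
    fix x assume x: "x \<longlonglongrightarrow> a"
    obtain B where B: "\<bar>fd \<epsilon> (x n) y\<bar> \<le> exp B * exp (- y)" for n y using bound[OF x] by blast
    show "(fd_energy \<epsilon> \<circ> x) \<longlonglongrightarrow> fd_energy \<epsilon> a"
      unfolding fd_energy_def o_def
    proof (rule integral_dominated_convergence[where w = "\<lambda>w. exp B * ((norm w)\<^sup>2 * exp (- (norm w)\<^sup>2))"])
      show "integrable lebesgue (\<lambda>w::velocity. exp B * ((norm w)\<^sup>2 * exp (- (norm w)\<^sup>2)))"
        by (intro integrable_mult_right integrable_gaussian_norm2)
      show "AE w::velocity in lebesgue. norm ((norm w)\<^sup>2 * fd \<epsilon> (x n) ((norm w)\<^sup>2)) \<le> exp B * ((norm w)\<^sup>2 * exp (- (norm w)\<^sup>2))" for n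
      proof (intro always_eventually allI)
        fix w :: velocity
        show "norm ((norm w)\<^sup>2 * fd \<epsilon> (x n) ((norm w)\<^sup>2)) \<le> exp B * ((norm w)\<^sup>2 * exp (- (norm w)\<^sup>2))"
          using mult_left_mono[OF B[of n "(norm w)\<^sup>2"] zero_le_power2[of "norm w"]]
          by (simp add: abs_mult ac_simps)
      qed
      show "AE w::velocity in lebesgue. (\<lambda>n. (norm w)\<^sup>2 * fd \<epsilon> (x n) ((norm w)\<^sup>2)) \<longlonglongrightarrow> (norm w)\<^sup>2 * fd \<epsilon> a ((norm w)\<^sup>2)"
        using fd_cont[OF x] by (auto intro!: tendsto_mult_left)
    qed (use borel_measurable_integrable[OF integrable_fd(2)[OF assms]] in auto)
  qed
qed

section \<open>The range of the scale invariant moment ratio\<close>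

text \<open>The exponents make the ratio invariant under dilations by \<open>s\<close>, which multiply the mass by \<open>s ^ 3\<close> and
  the energy by \<open>s ^ 5\<close>.\<close>

definition fd_ratio :: "real \<Rightarrow> real \<Rightarrow> real" where
  "fd_ratio \<epsilon> a = fd_mass \<epsilon> a ^ 5 / fd_energy \<epsilon> a ^ 3"

lemma isCont_fd_ratio: "0 \<le> \<epsilon> \<Longrightarrow> isCont (fd_ratio \<epsilon>) a"
  unfolding fd_ratio_def using isCont_fd_moments[of \<epsilon> a] fd_moments_pos[of \<epsilon> a]
  by (auto intro!: continuous_intros)

lemma fd_ratio_small:
  assumes \<epsilon>: "0 \<le> \<epsilon>" and q: "0 < q"
  shows "\<exists>a. fd_ratio \<epsilon> a < q"
proof -
  \<comment> \<open>Dilute regime: the profile is at most the Maxwellian and at least the Maxwellian divided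
    by \<open>1 + \<epsilon> * exp a\<close>, so up to these factors the ratio is the Maxwellian one, \<open>exp (2 * a) * G\<close>.\<close>
  define G where "G = fd_mass 0 0 ^ 5 / fd_energy 0 0 ^ 3"
  have le: "fd_ratio \<epsilon> a \<le> exp (2 * a) * (1 + \<epsilon> * exp a) ^ 3 * G" for a
  proof -
    have pos: "0 < 1 + \<epsilon> * exp a" using \<epsilon> by (simp add: add_pos_nonneg)
    have "fd_mass \<epsilon> a \<le> (LINT w|lebesgue. exp a * fd 0 0 ((norm (w::velocity))\<^sup>2))"
      unfolding fd_mass_def using fd_bounds(2)[OF \<epsilon>, of a]
      by (intro integral_mono integrable_mult_right integrable_fd \<epsilon>) (auto simp: fd_zero)
    then have m: "fd_mass \<epsilon> a \<le> exp a * fd_mass 0 0" by (simp add: fd_mass_def)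
    have "(LINT w|lebesgue. exp a / (1 + \<epsilon> * exp a) * ((norm (w::velocity))\<^sup>2 * fd 0 0 ((norm w)\<^sup>2))) \<le> fd_energy \<epsilon> a"
      unfolding fd_energy_def
    proof (intro integral_mono integrable_mult_right integrable_fd \<epsilon> order_refl)
      fix w :: velocity
      have "exp a / (1 + \<epsilon> * exp a) * fd 0 0 ((norm w)\<^sup>2) \<le> fd \<epsilon> a ((norm w)\<^sup>2)"
        using fd_bounds(4)[OF \<epsilon>, of "(norm w)\<^sup>2" a] by (simp add: fd_zero)
      from mult_left_mono[OF this, of "(norm w)\<^sup>2"]
      show "exp a / (1 + \<epsilon> * exp a) * ((norm w)\<^sup>2 * fd 0 0 ((norm w)\<^sup>2)) \<le> (norm w)\<^sup>2 * fd \<epsilon> a ((norm w)\<^sup>2)"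
        by (simp add: ac_simps)
    qed
    then have e: "exp a / (1 + \<epsilon> * exp a) * fd_energy 0 0 \<le> fd_energy \<epsilon> a" by (simp add: fd_energy_def)
    have "fd_ratio \<epsilon> a \<le> (exp a * fd_mass 0 0) ^ 5 / (exp a / (1 + \<epsilon> * exp a) * fd_energy 0 0) ^ 3"
      unfolding fd_ratio_def using m e fd_moments_pos[OF \<epsilon>, of a] fd_moments_pos[of 0 0] pos
      by (intro frac_le power_mono) auto
    also have "\<dots> = exp (2 * a) * (1 + \<epsilon> * exp a) ^ 3 * G"
    proof -
      have "exp a ^ 5 = exp (2 * a) * exp a ^ 3" by (simp add: exp_of_nat_mult[symmetric] exp_add[symmetric])
      then show ?thesis using pos by (simp add: G_def power_mult_distrib power_divide)
    qed
    finally show ?thesis .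
  qed
  have "((\<lambda>a. exp (2 * a) * (1 + \<epsilon> * exp a) ^ 3 * G) \<longlongrightarrow> 0 * (1 + \<epsilon> * 0) ^ 3 * G) at_bot"
  proof -
    have "((\<lambda>a::real. exp (2 * a)) \<longlongrightarrow> 0) at_bot" by real_asymp
    moreover have "(exp \<longlongrightarrow> (0::real)) at_bot" by (rule exp_at_bot)
    ultimately show ?thesis by (intro tendsto_intros)
  qed
  then have "\<forall>\<^sub>F a in at_bot. exp (2 * a) * (1 + \<epsilon> * exp a) ^ 3 * G < q"
    using q by (intro order_tendstoD(2)) auto
  then obtain a where "exp (2 * a) * (1 + \<epsilon> * exp a) ^ 3 * G < q"
    using eventually_happens'[OF trivial_limit_at_bot_linorder] by blast
  then have "fd_ratio \<epsilon> a < q" by (rule le_less_trans[OF le])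
  then show ?thesis by (rule exI)
qed

text \<open>In the Maxwellian case mass and energy are both proportional to \<open>exp a\<close>, so the ratio grows like
  \<open>exp (2 * a)\<close> without bound.\<close>

lemma fd_ratio_zero_large: "\<exists>a. q < fd_ratio 0 a"
proof -
  have "fd_mass 0 a = exp a * fd_mass 0 0" "fd_energy 0 a = exp a * fd_energy 0 0" for a
    by (simp_all add: fd_mass_def fd_energy_def fd_def exp_diff exp_minus divide_inverse mult.left_commute
        flip: integral_mult_right_zero)
  then have eq: "fd_ratio 0 a = exp (2 * a) * fd_ratio 0 0" for a
  proof -
    have "exp a ^ 5 = exp (2 * a) * exp a ^ 3" by (simp add: exp_of_nat_mult[symmetric] exp_add[symmetric])
    then show ?thesis
      using \<open>fd_mass 0 a = _\<close> \<open>fd_energy 0 a = _\<close> by (simp add: fd_ratio_def power_mult_distrib)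
  qed
  have pos: "0 < fd_ratio 0 0" using fd_moments_pos[of 0 0] by (simp add: fd_ratio_def)
  have "q < exp (2 * (q / fd_ratio 0 0)) * fd_ratio 0 0"
  proof -
    have "q / fd_ratio 0 0 < exp (2 * (q / fd_ratio 0 0))"
      using exp_ge_add_one_self[of "2 * (q / fd_ratio 0 0)"] exp_gt_zero[of "2 * (q / fd_ratio 0 0)"] by linarith
    then show ?thesis using pos by (simp add: pos_divide_less_eq)
  qed
  then show ?thesis using eq by metis
qed

text \<open>With \<open>a = t\<^sup>2 - ln \<epsilon>\<close> and lengths measured in units of \<open>t\<close>, the profile is
  \<open>1 / (\<epsilon> * (1 + exp (t\<^sup>2 * ((norm y)\<^sup>2 - 1))))\<close>: as \<open>t\<close> grows it converges, off the unit sphere, to the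
  completely filled ball.\<close>

lemma fd_degenerate_limit:
  fixes g :: "velocity \<Rightarrow> real"
  assumes \<epsilon>: "0 < \<epsilon>" and g: "g \<in> borel_measurable borel" "\<And>y. 0 \<le> g y"
    and int: "integrable lebesgue (\<lambda>y. g y * exp (- (norm y)\<^sup>2))"
  shows "((\<lambda>t. LINT y|lebesgue. g y * fd \<epsilon> (t\<^sup>2 - ln \<epsilon>) (t\<^sup>2 * (norm y)\<^sup>2)) \<longlongrightarrow>
           (LINT y|lebesgue. indicator (ball 0 1) y * g y) / \<epsilon>) at_top"
proof -
  note [measurable] = g(1)
  have fd: "fd \<epsilon> (t\<^sup>2 - ln \<epsilon>) (t\<^sup>2 * z) = 1 / (\<epsilon> * (1 + exp (t\<^sup>2 * (z - 1))))" for t z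
  proof -
    have "exp (t\<^sup>2 - ln \<epsilon> - t\<^sup>2 * z) = inverse (exp (t\<^sup>2 * (z - 1))) / \<epsilon>"
      using \<epsilon> by (simp add: exp_diff exp_add exp_minus field_simps)
    then have "exp (t\<^sup>2 - ln \<epsilon> - t\<^sup>2 * z) * (\<epsilon> * exp (t\<^sup>2 * (z - 1))) = 1"
      using \<epsilon> by simp
    moreover have "X / (1 + \<epsilon> * X) = 1 / (\<epsilon> * (1 + Y))" if "X * (\<epsilon> * Y) = 1" "0 < X" "0 < Y" for X Y
      using that \<epsilon> by (subst frac_eq_eq) (auto simp: algebra_simps add_nonneg_eq_0_iff)
    ultimately show ?thesis unfolding fd_def by simp
  qed
  have "((\<lambda>t. LINT y|lebesgue. g y * fd \<epsilon> (t\<^sup>2 - ln \<epsilon>) (t\<^sup>2 * (norm y)\<^sup>2)) \<longlongrightarrow>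
           (LINT y|lebesgue. indicator (ball 0 1) y * g y / \<epsilon>)) at_top"
  proof (rule integral_dominated_convergence_at_top[where w = "\<lambda>y. exp 1 / \<epsilon> * (g y * exp (- (norm y)\<^sup>2))"])
    show "\<forall>\<^sub>F t in at_top. AE y in lebesgue. norm (g y * fd \<epsilon> (t\<^sup>2 - ln \<epsilon>) (t\<^sup>2 * (norm y)\<^sup>2))
        \<le> exp 1 / \<epsilon> * (g y * exp (- (norm y)\<^sup>2))"
      using eventually_ge_at_top[of 1]
    proof eventually_elim
      case (elim t)
      \<comment> \<open>Since \<open>t \<ge> 1\<close>, one fixed Gaussian dominates both the plateau \<open>z \<le> 1\<close> and the tail.\<close>
      have "1 / (\<epsilon> * (1 + exp (t\<^sup>2 * (z - 1)))) \<le> exp (1 - z) / \<epsilon>" for z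
      proof (cases "1 \<le> z")
        case True
        then have "exp (z - 1) \<le> exp (t\<^sup>2 * (z - 1))" using elim by (simp add: mult_le_cancel_right1)
        then have "exp (z - 1) \<le> 1 + exp (t\<^sup>2 * (z - 1))" by linarith
        then have "1 / (1 + exp (t\<^sup>2 * (z - 1))) \<le> 1 / exp (z - 1)"
          by (intro divide_left_mono mult_pos_pos add_pos_pos) auto
        also have "\<dots> = exp (1 - z)" by (simp add: exp_diff)
        finally have "1 / (1 + exp (t\<^sup>2 * (z - 1))) / \<epsilon> \<le> exp (1 - z) / \<epsilon>"
          using \<epsilon> by (intro divide_right_mono) auto
        then show ?thesis by (simp add: mult.commute)
      next
        case False
        have "1 / (1 + exp (t\<^sup>2 * (z - 1))) \<le> 1" by (simp add: add_pos_pos)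
        also have "1 \<le> exp (1 - z)" using False by simp
        finally have "1 / (1 + exp (t\<^sup>2 * (z - 1))) / \<epsilon> \<le> exp (1 - z) / \<epsilon>"
          using \<epsilon> by (intro divide_right_mono) auto
        then show ?thesis by (simp add: mult.commute)
      qed
      note * = this
      have "g y * (1 / (\<epsilon> * (1 + exp (t\<^sup>2 * ((norm y)\<^sup>2 - 1))))) \<le> g y * (exp (1 - (norm y)\<^sup>2) / \<epsilon>)" for y
        using * g(2) by (rule mult_left_mono)
      moreover have "exp (1 - z) / \<epsilon> = exp 1 / \<epsilon> * exp (- z)" for z :: real
        by (simp add: exp_diff exp_minus divide_inverse)
      moreover have "0 \<le> 1 / (\<epsilon> * (1 + exp (t\<^sup>2 * (z - 1))))" for z
        using \<epsilon> by (simp add: add_nonneg_nonneg)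
      ultimately show ?case using g(2) \<epsilon> unfolding fd by (auto simp: abs_mult ac_simps)
    qed
    have "AE y::velocity in lebesgue. y \<notin> sphere 0 1"
      using negligible_sphere[of "0::velocity" 1] by (intro AE_not_in) (simp add: negligible_iff_null_sets)
    then show "AE y in lebesgue. ((\<lambda>t. g y * fd \<epsilon> (t\<^sup>2 - ln \<epsilon>) (t\<^sup>2 * (norm y)\<^sup>2)) \<longlongrightarrow> indicator (ball 0 1) y * g y / \<epsilon>) at_top"
    proof eventually_elim
      case (elim y)
      have "((\<lambda>t. 1 / (\<epsilon> * (1 + exp (t\<^sup>2 * ((norm y)\<^sup>2 - 1))))) \<longlongrightarrow> indicator (ball 0 1) y / \<epsilon>) at_top"
      proof (cases "norm y < 1")
        case True
        define k where "k = 1 - (norm y)\<^sup>2"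
        have "0 < k" using True by (simp add: k_def power_less_one_iff abs_square_less_1)
        then have "((\<lambda>t::real. exp (- (t\<^sup>2 * k))) \<longlongrightarrow> 0) at_top" by real_asymp
        then have "((\<lambda>t. 1 / (\<epsilon> * (1 + exp (- (t\<^sup>2 * k))))) \<longlongrightarrow> 1 / (\<epsilon> * (1 + 0))) at_top"
          using \<epsilon> by (intro tendsto_intros) auto
        moreover have "t\<^sup>2 * ((norm y)\<^sup>2 - 1) = - (t\<^sup>2 * k)" for t by (simp add: k_def algebra_simps)
        ultimately show ?thesis using True by simp
      next
        case False
        with elim have "1 < norm y" by simp
        define k where "k = (norm y)\<^sup>2 - 1"
        have "0 < k" using \<open>1 < norm y\<close> by (simp add: k_def one_less_power)
        then have "((\<lambda>t::real. 1 / (\<epsilon> * (1 + exp (t\<^sup>2 * k)))) \<longlongrightarrow> 0) at_top" using \<epsilon> by real_asymp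
        then show ?thesis using False by (simp add: k_def)
      qed
      from tendsto_mult_left[OF this, of "g y"] show ?case by (simp add: fd ac_simps)
    qed
    show "(\<lambda>y. indicator (ball 0 1) y * g y / \<epsilon>) \<in> borel_measurable lebesgue"
      by (intro borel_measurable_lebesgueI borel_measurable_divide borel_measurable_times
          borel_measurable_indicator g(1)) auto
    show "(\<lambda>y. g y * fd \<epsilon> (t\<^sup>2 - ln \<epsilon>) (t\<^sup>2 * (norm y)\<^sup>2)) \<in> borel_measurable lebesgue" for t
      by (rule borel_measurable_lebesgueI) measurable
    show "integrable lebesgue (\<lambda>y. exp 1 / \<epsilon> * (g y * exp (- (norm y)\<^sup>2)))"
      using int by (rule integrable_mult_right)
  qed
  then show ?thesis by (simp only: integral_divide_zero)
qed

lemma fd_ratio_large: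
  assumes \<epsilon>: "0 < \<epsilon>" and q: "q < 125 / 27 * (4 / 3 * pi / \<epsilon>)\<^sup>2"
  shows "\<exists>a. q < fd_ratio \<epsilon> a"
proof -
  \<comment> \<open>Measured in units of the Fermi radius \<open>t\<close>, where \<open>t\<^sup>2 = a + ln \<epsilon>\<close>, mass and energy tend to those
    of the unit ball with density \<open>1 / \<epsilon>\<close>; the powers of \<open>t\<close> cancel in the ratio.\<close>
  define V I where "V = 4 / 3 * pi" and "I = (LINT y|lebesgue. indicator (ball 0 1) y * (norm (y::velocity))\<^sup>2)"
  define m where "m t = (LINT y|lebesgue. 1 * fd \<epsilon> (t\<^sup>2 - ln \<epsilon>) (t\<^sup>2 * (norm (y::velocity))\<^sup>2))" for t
  define e where "e t = (LINT y|lebesgue. (norm (y::velocity))\<^sup>2 * fd \<epsilon> (t\<^sup>2 - ln \<epsilon>) (t\<^sup>2 * (norm y)\<^sup>2))" for t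
  have vol: "(LINT y|lebesgue. indicator (ball (0::velocity) 1) y * 1) = V"
    using content_ball[of 1 "0::velocity"] by (simp add: V_def unit_ball_vol_3)
  have m: "(m \<longlongrightarrow> V / \<epsilon>) at_top"
    unfolding m_def vol[symmetric] using integrable_gaussian[of 1] by (intro fd_degenerate_limit \<epsilon>) auto
  have e: "(e \<longlongrightarrow> I / \<epsilon>) at_top"
    unfolding e_def I_def using integrable_gaussian_norm2 by (intro fd_degenerate_limit \<epsilon>) auto
  have I_pos: "0 < I"
  proof -
    have "0 \<le> I" unfolding I_def by (intro integral_nonneg_AE) auto
    moreover have "I \<noteq> 0"
    proof
      assume "I = 0"
      then have "AE y::velocity in lebesgue. indicator (ball 0 1) y * (norm y)\<^sup>2 = (0::real)"
        using integral_nonneg_eq_0_iff_AE[OF integrable_ball_norm2[where 'a = velocity and r = 1]]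
        by (simp add: I_def)
      then have "AE y::velocity in lebesgue. y \<notin> ball 0 1"
        using AE_lebesgue_neq[of 0] by eventually_elim auto
      then have "negligible (ball (0::velocity) 1)"
        by (simp add: completion.AE_iff_null_sets negligible_iff_null_sets ball_def)
      then show False using open_not_negligible[of "ball (0::velocity) 1"] by simp
    qed
    ultimately show ?thesis by simp
  qed
  have I_le: "I \<le> 3 / 5 * V" using ball_second_moment by (simp add: I_def V_def)
  have V: "0 < V" by (simp add: V_def)
  have ratio: "fd_ratio \<epsilon> (t\<^sup>2 - ln \<epsilon>) = m t ^ 5 / e t ^ 3" if t: "0 < t" for t
  proof -
    have "fd_mass \<epsilon> (t\<^sup>2 - ln \<epsilon>) =
        (LINT w|lebesgue. fd \<epsilon> (t\<^sup>2 - ln \<epsilon>) (t\<^sup>2 * (norm ((w - 0::velocity) /\<^sub>R t))\<^sup>2))"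
      unfolding fd_mass_def norm_sq_scaled using t by simp
    also have "\<dots> = t ^ 3 * m t"
      using t by (subst lebesgue_integral_affine(1)) (auto simp: m_def)
    finally have 1: "fd_mass \<epsilon> (t\<^sup>2 - ln \<epsilon>) = t ^ 3 * m t" .
    have "fd_energy \<epsilon> (t\<^sup>2 - ln \<epsilon>) =
        (LINT w|lebesgue. t\<^sup>2 * ((norm ((w - 0::velocity) /\<^sub>R t))\<^sup>2 * fd \<epsilon> (t\<^sup>2 - ln \<epsilon>) (t\<^sup>2 * (norm ((w - 0::velocity) /\<^sub>R t))\<^sup>2)))"
      unfolding fd_energy_def norm_sq_scaled using t by simp
    also have "\<dots> = t\<^sup>2 * (t ^ 3 * e t)"
      using t by (subst integral_mult_right_zero, subst lebesgue_integral_affine(1)) (auto simp: e_def)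
    finally have 2: "fd_energy \<epsilon> (t\<^sup>2 - ln \<epsilon>) = t\<^sup>2 * (t ^ 3 * e t)" .
    have "(t ^ 3 * m t) ^ 5 = t ^ 15 * m t ^ 5" "(t\<^sup>2 * (t ^ 3 * e t)) ^ 3 = t ^ 15 * e t ^ 3"
      by (simp_all add: power_mult_distrib power_mult[symmetric] power_add[symmetric] flip: mult.assoc)
    then show ?thesis using t unfolding fd_ratio_def 1 2 by simp
  qed
  have lim: "((\<lambda>t. m t ^ 5 / e t ^ 3) \<longlongrightarrow> (V / \<epsilon>) ^ 5 / (I / \<epsilon>) ^ 3) at_top"
    using I_pos \<epsilon> by (intro tendsto_intros m e) auto
  have "q < (V / \<epsilon>) ^ 5 / (3 / 5 * (V / \<epsilon>)) ^ 3"
  proof -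
    have "(V / \<epsilon>) ^ 5 / (3 / 5 * (V / \<epsilon>)) ^ 3 = 125 / 27 * (V / \<epsilon>)\<^sup>2"
      using V \<epsilon> by (simp add: field_simps eval_nat_numeral)
    then show ?thesis using q unfolding V_def by (simp only:)
  qed
  also have "\<dots> \<le> (V / \<epsilon>) ^ 5 / (I / \<epsilon>) ^ 3"
    using I_le I_pos V \<epsilon> by (intro divide_left_mono power_mono) (auto simp: field_simps)
  finally have "\<forall>\<^sub>F t in at_top. q < m t ^ 5 / e t ^ 3" by (rule order_tendstoD(1)[OF lim])
  then have "\<forall>\<^sub>F t in at_top. q < m t ^ 5 / e t ^ 3 \<and> 0 < t"
    by (intro eventually_conj eventually_gt_at_top)
  then obtain t where "q < m t ^ 5 / e t ^ 3" "0 < t"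
    using eventually_happens'[OF trivial_limit_at_top_linorder] by blast
  then have "q < fd_ratio \<epsilon> (t\<^sup>2 - ln \<epsilon>)" by (simp only: ratio)
  then show ?thesis by (rule exI)
qed

lemma fd_ratio_attained:
  assumes \<epsilon>: "0 \<le> \<epsilon>" and q: "0 < q" "0 < \<epsilon> \<Longrightarrow> q < 125 / 27 * (4 / 3 * pi / \<epsilon>)\<^sup>2"
  shows "\<exists>a. fd_ratio \<epsilon> a = q"
proof -
  obtain a b where "fd_ratio \<epsilon> a < q" "q < fd_ratio \<epsilon> b"
    using fd_ratio_small[OF \<epsilon> q(1)] fd_ratio_zero_large[of q] fd_ratio_large[OF _ q(2)] \<epsilon>
    by (cases "\<epsilon> = 0") force+
  moreover have "connected (range (fd_ratio \<epsilon>))"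
    by (intro connected_continuous_image continuous_at_imp_continuous_on) (auto intro: isCont_fd_ratio \<epsilon>)
  ultimately have "q \<in> range (fd_ratio \<epsilon>)"
    by (meson connectedD_interval less_imp_le rangeI)
  then show ?thesis by auto
qed

section \<open>Existence and uniqueness of the equilibrium\<close>

definition same_moments :: "(velocity \<Rightarrow> real) \<Rightarrow> (velocity \<Rightarrow> real) \<Rightarrow> bool" where
  "same_moments g h \<longleftrightarrow>
     (LINT v|lebesgue. g v) = (LINT v|lebesgue. h v) \<and>
     (LINT v|lebesgue. g v *\<^sub>R v) = (LINT v|lebesgue. h v *\<^sub>R v) \<and>
     (LINT v|lebesgue. g v * (norm v)\<^sup>2) = (LINT v|lebesgue. h v * (norm v)\<^sup>2)"

lemma L1_2D:
  assumes "g \<in> L1_2"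
  shows "integrable lebesgue g" "integrable lebesgue (\<lambda>v. g v *\<^sub>R v)"
    and "integrable lebesgue (\<lambda>v. g v * (norm v)\<^sup>2)"
proof -
  have g [measurable]: "g \<in> borel_measurable lebesgue"
    and int: "integrable lebesgue (\<lambda>v. \<bar>g v\<bar> * (1 + (norm v)\<^sup>2))" using assms by (auto simp: L1_2_def)
  have id [measurable]: "(\<lambda>v::velocity. v) \<in> borel_measurable lebesgue"
    by (rule borel_measurable_lebesgueI) simp
  have le: "norm v \<le> 1 + (norm v)\<^sup>2" for v :: velocity
    using sum_squares_bound[of 1 "norm v"] norm_ge_zero[of v] by (simp del: norm_ge_zero)
  show "integrable lebesgue g"
    by (rule Bochner_Integration.integrable_bound[OF int])
       (use g in \<open>auto simp: abs_mult distrib_left\<close>)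
  show "integrable lebesgue (\<lambda>v. g v *\<^sub>R v)"
    by (rule Bochner_Integration.integrable_bound[OF int])
       (use le in \<open>auto simp: abs_mult intro!: mult_left_mono\<close>)
  show "integrable lebesgue (\<lambda>v. g v * (norm v)\<^sup>2)"
    by (rule Bochner_Integration.integrable_bound[OF int])
       (auto simp: abs_mult distrib_left)
qed

lemma second_moment_about:
  assumes "g \<in> L1_2"
  shows "integrable lebesgue (\<lambda>v. g v * (norm (v - u))\<^sup>2)"
    and "(LINT v|lebesgue. g v * (norm (v - u))\<^sup>2) =
      (LINT v|lebesgue. g v * (norm v)\<^sup>2) - 2 * (u \<bullet> (LINT v|lebesgue. g v *\<^sub>R v)) + (norm u)\<^sup>2 * (LINT v|lebesgue. g v)"
proof -
  note int = L1_2D[OF assms]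
  have eq: "g v * (norm (v - u))\<^sup>2 = g v * (norm v)\<^sup>2 - 2 * (u \<bullet> (g v *\<^sub>R v)) + (norm u)\<^sup>2 * g v" for v
    by (simp add: power2_norm_eq_inner inner_simps algebra_simps inner_commute)
  have i2: "integrable lebesgue (\<lambda>v. u \<bullet> (g v *\<^sub>R v))" using int(2) by (rule integrable_inner_right)
  show "integrable lebesgue (\<lambda>v. g v * (norm (v - u))\<^sup>2)"
    unfolding eq using int i2 by auto
  have "(LINT v|lebesgue. u \<bullet> (g v *\<^sub>R v)) = u \<bullet> (LINT v|lebesgue. g v *\<^sub>R v)"
    using int(2) by (intro integral_inner_right) auto
  then show "(LINT v|lebesgue. g v * (norm (v - u))\<^sup>2) =
      (LINT v|lebesgue. g v * (norm v)\<^sup>2) - 2 * (u \<bullet> (LINT v|lebesgue. g v *\<^sub>R v)) + (norm u)\<^sup>2 * (LINT v|lebesgue. g v)"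
    unfolding eq using int i2 by (simp del: inner_scaleR_right)
qed

text \<open>All moments follow from those of the profile by the substitution \<open>v = u + s *\<^sub>R w\<close>; the momentum relative
  to the centre is the integral of an odd function.\<close>

lemma fd_state_moments:
  assumes \<epsilon>: "0 \<le> \<epsilon>" and s: "0 < s"
  shows "fd_state \<epsilon> a u s \<in> L1_2"
    and "(LINT v|lebesgue. fd_state \<epsilon> a u s v) = s ^ 3 * fd_mass \<epsilon> a"
    and "(LINT v|lebesgue. fd_state \<epsilon> a u s v *\<^sub>R v) = (LINT v|lebesgue. fd_state \<epsilon> a u s v) *\<^sub>R u"
    and "(LINT v|lebesgue. fd_state \<epsilon> a u s v * (norm (v - u))\<^sup>2) = s ^ 5 * fd_energy \<epsilon> a"
proof -
  let ?M = "fd_state \<epsilon> a u s"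
  have pos: "0 < ?M v" for v by (simp add: fd_state_def fd_bounds(1)[OF \<epsilon>])
  define h2 where "h2 = (\<lambda>w::velocity. (norm w)\<^sup>2 * fd \<epsilon> a ((norm w)\<^sup>2))"
  define h3 where "h3 = (\<lambda>w::velocity. fd \<epsilon> a ((norm w)\<^sup>2) *\<^sub>R w)"
  have [measurable]: "h2 \<in> borel_measurable borel" "h3 \<in> borel_measurable borel"
    unfolding h2_def h3_def by measurable
  have e2: "?M v * (norm (v - u))\<^sup>2 = s\<^sup>2 * h2 ((v - u) /\<^sub>R s)" for v
    using s by (simp add: h2_def fd_state_def norm_sq_scaled del: norm_scaleR)
  have e3: "?M v *\<^sub>R (v - u) = s *\<^sub>R h3 ((v - u) /\<^sub>R s)" for v
    using s by (simp add: h3_def fd_state_def)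
  have i1: "integrable lebesgue ?M"
    using integrable_fd(1)[OF \<epsilon>, where 'a = velocity and a = a] s unfolding fd_state_def
    by (subst lebesgue_integral_affine(2)) auto
  have i2: "integrable lebesgue (\<lambda>v. ?M v * (norm (v - u))\<^sup>2)"
    using integrable_fd(2)[OF \<epsilon>, where 'a = velocity and a = a] s unfolding e2
    by (intro integrable_mult_right, subst lebesgue_integral_affine(2)) (auto simp: h2_def)
  show L: "?M \<in> L1_2"
  proof -
    have "integrable lebesgue (\<lambda>v. \<bar>?M v\<bar> * (1 + (norm v)\<^sup>2))"
    proof (rule Bochner_Integration.integrable_bound)
      show "integrable lebesgue (\<lambda>v. (1 + 2 * (norm u)\<^sup>2) * ?M v + 2 * (?M v * (norm (v - u))\<^sup>2))"
        using i1 i2 by auto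
      have "(norm v)\<^sup>2 \<le> 2 * (norm (v - u))\<^sup>2 + 2 * (norm u)\<^sup>2" for v :: velocity
      proof -
        have "(norm v)\<^sup>2 \<le> (norm (v - u) + norm u)\<^sup>2"
          using norm_triangle_ineq[of "v - u" u] by (intro power_mono) auto
        also have "\<dots> \<le> 2 * (norm (v - u))\<^sup>2 + 2 * (norm u)\<^sup>2"
          using sum_squares_bound[of "norm (v - u)" "norm u"] by (simp add: power2_sum)
        finally show ?thesis .
      qed
      then have "1 + (norm v)\<^sup>2 \<le> 1 + 2 * (norm u)\<^sup>2 + 2 * (norm (v - u))\<^sup>2" for v :: velocity
        by (simp add: add.commute)
      from mult_left_mono[OF this less_imp_le[OF pos]]
      have "\<bar>\<bar>?M v\<bar> * (1 + (norm v)\<^sup>2)\<bar> \<le> \<bar>(1 + 2 * (norm u)\<^sup>2) * ?M v + 2 * (?M v * (norm (v - u))\<^sup>2)\<bar>" for v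
        using pos[of v] by (simp add: abs_of_nonneg algebra_simps)
      then show "AE v in lebesgue. norm (\<bar>?M v\<bar> * (1 + (norm v)\<^sup>2)) \<le> norm ((1 + 2 * (norm u)\<^sup>2) * ?M v + 2 * (?M v * (norm (v - u))\<^sup>2))"
        by simp
    qed (rule borel_measurable_lebesgueI, measurable)
    then show ?thesis by (auto simp: L1_2_def intro: borel_measurable_lebesgueI)
  qed
  show "(LINT v|lebesgue. ?M v) = s ^ 3 * fd_mass \<epsilon> a"
    unfolding fd_state_def fd_mass_def using s by (subst lebesgue_integral_affine(1)) auto
  show "(LINT v|lebesgue. ?M v * (norm (v - u))\<^sup>2) = s ^ 5 * fd_energy \<epsilon> a"
    unfolding e2 using s
    by (subst integral_mult_right_zero, subst lebesgue_integral_affine(1))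
       (auto simp: h2_def fd_energy_def power_add[symmetric] simp flip: mult.assoc)
  have odd: "(LINT w|lebesgue. h3 w) = 0"
  proof -
    have "(LINT w|lebesgue. h3 ((w - 0) /\<^sub>R (-1))) = (LINT w|lebesgue. h3 w)"
      by (subst lebesgue_integral_affine(1)) auto
    moreover have "h3 ((w - 0) /\<^sub>R (-1)) = - h3 w" for w by (simp add: h3_def)
    ultimately have "- (LINT w|lebesgue. h3 w) = (LINT w|lebesgue. h3 w)" by simp
    then have "(2::real) *\<^sub>R (LINT w|lebesgue. h3 w) = 0"
      unfolding scaleR_2 by (metis add.left_inverse)
    then show ?thesis by simp
  qed
  have "(LINT v|lebesgue. ?M v *\<^sub>R v - ?M v *\<^sub>R u) = 0"
    unfolding scaleR_diff_right[symmetric] e3 using s odd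
    by (subst integral_scaleR_right, subst lebesgue_integral_affine(1)) auto
  then show "(LINT v|lebesgue. ?M v *\<^sub>R v) = (LINT v|lebesgue. ?M v) *\<^sub>R u"
    using L1_2D(2)[OF L] i1 by simp
qed

lemma fermi_dirac_L1_2: "0 \<le> \<epsilon> \<Longrightarrow> M \<in> fermi_dirac \<epsilon> \<Longrightarrow> M \<in> L1_2"
  unfolding fermi_dirac_iff using fd_state_moments(1) by auto

lemma fermi_dirac_bounds:
  assumes "0 \<le> \<epsilon>" "M \<in> fermi_dirac \<epsilon>"
  shows "0 < M v" "\<epsilon> * M v < 1"
  using assms fd_bounds by (auto simp: fermi_dirac_iff fd_state_def)

text \<open>The entropy variable of an equilibrium is a combination of the conserved quantities \<open>1\<close>, \<open>v\<close> and
  \<open>(norm v)\<^sup>2\<close>, hence does not see the difference of two functions with the same moments.\<close>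

lemma fermi_dirac_orthogonal:
  assumes \<epsilon>: "0 \<le> \<epsilon>" and M: "M \<in> fermi_dirac \<epsilon>"
    and gh: "g \<in> L1_2" "h \<in> L1_2" "same_moments g h"
  shows "integrable lebesgue (\<lambda>v. ln (phi \<epsilon> (M v)) * (g v - h v))"
    and "(LINT v|lebesgue. ln (phi \<epsilon> (M v)) * (g v - h v)) = 0"
proof -
  obtain a u s where s: "0 < s" and M: "M = fd_state \<epsilon> a u s" using M by (auto simp: fermi_dirac_iff)
  have eq: "ln (phi \<epsilon> (M v)) * (g v - h v) =
      (a * g v - (g v * (norm (v - u))\<^sup>2) / s\<^sup>2) - (a * h v - (h v * (norm (v - u))\<^sup>2) / s\<^sup>2)" for v
  proof -
    have "ln (phi \<epsilon> (M v)) = a - (norm (v - u))\<^sup>2 / s\<^sup>2"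
      by (simp add: M fd_state_def ln_phi_fd[OF \<epsilon>] norm_sq_scaled del: norm_scaleR)
    then show ?thesis by (simp only:) (simp add: left_diff_distrib right_diff_distrib diff_divide_distrib mult.commute)
  qed
  have ints: "integrable lebesgue (\<lambda>v. a * k v - (k v * (norm (v - u))\<^sup>2) / s\<^sup>2)" if "k \<in> L1_2" for k
    using L1_2D(1)[OF that] second_moment_about(1)[OF that] by auto
  have vals: "(LINT v|lebesgue. a * k v - (k v * (norm (v - u))\<^sup>2) / s\<^sup>2) =
      a * (LINT v|lebesgue. k v) - ((LINT v|lebesgue. k v * (norm v)\<^sup>2) - 2 * (u \<bullet> (LINT v|lebesgue. k v *\<^sub>R v)) + (norm u)\<^sup>2 * (LINT v|lebesgue. k v)) / s\<^sup>2"
    if "k \<in> L1_2" for k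
    using L1_2D(1)[OF that] second_moment_about[OF that] by simp
  show "integrable lebesgue (\<lambda>v. ln (phi \<epsilon> (M v)) * (g v - h v))"
    unfolding eq using ints gh by auto
  show "(LINT v|lebesgue. ln (phi \<epsilon> (M v)) * (g v - h v)) = 0"
    unfolding eq using gh by (subst Bochner_Integration.integral_diff) (auto simp: ints vals same_moments_def)
qed

text \<open>By orthogonality the integral of \<open>(ln (phi \<epsilon> (M v)) - ln (phi \<epsilon> (N v))) * (M v - N v)\<close> is zero, while
  monotonicity of \<open>phi \<epsilon>\<close> makes the integrand positive wherever \<open>M\<close> and \<open>N\<close> differ.\<close>

lemma fermi_dirac_unique:
  assumes \<epsilon>: "0 \<le> \<epsilon>" and M: "M \<in> fermi_dirac \<epsilon>" and N: "N \<in> fermi_dirac \<epsilon>" and eq: "same_moments M N"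
  shows "M = N"
proof -
  note L = fermi_dirac_L1_2[OF \<epsilon> M] fermi_dirac_L1_2[OF \<epsilon> N]
  \<comment> \<open>The symmetrised relative entropy density of \<open>M\<close> and \<open>N\<close>.\<close>
  define D where "D v = ln (phi \<epsilon> (M v)) * (M v - N v) - ln (phi \<epsilon> (N v)) * (M v - N v)" for v
  have D: "integrable lebesgue D" "(LINT v|lebesgue. D v) = 0"
    unfolding D_def using fermi_dirac_orthogonal[OF \<epsilon> M L eq] fermi_dirac_orthogonal[OF \<epsilon> N L eq] by auto
  have mono: "ln (phi \<epsilon> x) < ln (phi \<epsilon> y)" if "0 < x" "x < y" "\<epsilon> * y < 1" for x y
  proof -
    have "\<epsilon> * x \<le> \<epsilon> * y" using \<epsilon> that by (intro mult_left_mono) auto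
    then have "phi \<epsilon> x < phi \<epsilon> y" "0 < phi \<epsilon> x"
      unfolding phi_def using that by (auto intro!: frac_less divide_pos_pos)
    then show ?thesis by simp
  qed
  have sign: "0 \<le> D v \<and> (D v = 0 \<longrightarrow> M v = N v)" for v
  proof -
    have "D v = (ln (phi \<epsilon> (M v)) - ln (phi \<epsilon> (N v))) * (M v - N v)" by (simp add: D_def left_diff_distrib)
    with mono[of "M v" "N v"] mono[of "N v" "M v"] fermi_dirac_bounds[OF \<epsilon> M, of v] fermi_dirac_bounds[OF \<epsilon> N, of v]
    show ?thesis by (cases "M v" "N v" rule: linorder_cases) (auto simp: zero_le_mult_iff)
  qed
  then have "AE v in lebesgue. D v = 0" using D integral_nonneg_eq_0_iff_AE[of lebesgue D] by simp
  then have "AE v in lebesgue. M v = N v" by eventually_elim (simp add: sign)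
  moreover have "continuous_on UNIV K" if K: "K \<in> fermi_dirac \<epsilon>" for K
  proof -
    obtain a u s where "0 < s" "K = fd_state \<epsilon> a u s" using K by (auto simp: fermi_dirac_iff)
    then show ?thesis unfolding fd_state_def fd_def using \<epsilon>
      by (auto intro!: continuous_intros simp: add_nonneg_eq_0_iff)
  qed
  ultimately show ?thesis using M N by (intro continuous_AE_eq_imp_eq) simp_all
qed

lemma fermi_dirac_exists:
  assumes \<epsilon>: "0 \<le> \<epsilon>" and f: "f \<in> L1_2" "AE v in lebesgue. 0 \<le> f v" "\<not> (AE v in lebesgue. f v = 0)"
    and ratio: "0 < \<epsilon> \<Longrightarrow> 2 / 5 < temperature_ratio \<epsilon> f"
  shows "\<exists>M\<in>fermi_dirac \<epsilon>. same_moments M f"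
proof -
  define \<rho> u E where "\<rho> = mass f" and "u = bulk_velocity f"
    and "E = (LINT v|lebesgue. f v * (norm (v - u))\<^sup>2)"
  note int = L1_2D[OF f(1)]
  have \<rho>: "0 < \<rho>"
    using integral_nonneg_eq_0_iff_AE[OF int(1) f(2)] f(3) integral_nonneg_AE[OF f(2)]
    by (simp add: \<rho>_def mass_def less_le)
  have mom: "(LINT v|lebesgue. f v *\<^sub>R v) = \<rho> *\<^sub>R u"
    using \<rho> by (simp add: u_def bulk_velocity_def \<rho>_def)
  have nn: "AE v in lebesgue. 0 \<le> f v * (norm (v - u))\<^sup>2" using f(2) by eventually_elim simp
  have E: "0 < E"
  proof -
    have "E \<noteq> 0"
    proof
      assume "E = 0"
      then have "AE v in lebesgue. f v * (norm (v - u))\<^sup>2 = 0"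
        using integral_nonneg_eq_0_iff_AE[OF second_moment_about(1)[OF f(1)] nn] by (simp add: E_def)
      then have "AE v in lebesgue. f v = 0" using AE_lebesgue_neq[of u] by eventually_elim auto
      with f(3) show False by simp
    qed
    moreover have "0 \<le> E" unfolding E_def using nn by (rule integral_nonneg_AE)
    ultimately show ?thesis by simp
  qed
  have ET: "E = 3 * \<rho> * temperature f"
  proof -
    have "E = (LINT v|lebesgue. f v * (norm v)\<^sup>2) - \<rho> * (norm u)\<^sup>2"
      unfolding E_def second_moment_about(2)[OF f(1)] mom
      by (simp add: \<rho>_def mass_def power2_norm_eq_inner)
    then show ?thesis using \<rho> by (simp add: temperature_def \<rho>_def u_def)
  qed
  \<comment> \<open>Fix the degeneracy parameter by the scale invariant ratio; the length scale then matches
    the mass, and the energy follows.\<close>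
  have "\<exists>a. fd_ratio \<epsilon> a = \<rho> ^ 5 / E ^ 3"
  proof (rule fd_ratio_attained[OF \<epsilon>])
    show "0 < \<rho> ^ 5 / E ^ 3" using \<rho> E by simp
    assume \<epsilon>: "0 < \<epsilon>"
    define X where "X = 3 * \<epsilon> * \<rho> / (4 * pi)"
    have X: "0 < X" using \<epsilon> \<rho> by (simp add: X_def)
    have "1 / 5 * X powr (2 / 3) < temperature f"
      using ratio[OF \<epsilon>] X by (simp add: temperature_ratio_def fermi_temperature_def pos_less_divide_eq flip: X_def \<rho>_def)
    then have "(1 / 5 * X powr (2 / 3)) ^ 3 < temperature f ^ 3" by (intro power_strict_mono) auto
    moreover have "(1 / 5 * X powr (2 / 3)) ^ 3 = X\<^sup>2 / 125"
      using X by (simp add: power_mult_distrib power_divide powr_power)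
    ultimately have T: "X\<^sup>2 / 125 < temperature f ^ 3" by simp
    have "\<rho> ^ 5 / E ^ 3 = \<rho>\<^sup>2 / (27 * temperature f ^ 3)"
      using \<rho> E unfolding ET by (simp add: power_mult_distrib field_simps eval_nat_numeral)
    also have "\<dots> < \<rho>\<^sup>2 / (27 * (X\<^sup>2 / 125))"
    proof -
      have "0 < X\<^sup>2 / 125" using X by simp
      moreover from this T have "0 < temperature f ^ 3" by (rule less_trans)
      ultimately show ?thesis using T \<rho> by (intro divide_strict_left_mono mult_pos_pos) auto
    qed
    also have "\<dots> = 125 / 27 * (4 / 3 * pi / \<epsilon>)\<^sup>2"
      using \<rho> \<epsilon> by (simp add: X_def field_simps power_mult_distrib power_divide)
    finally show "\<rho> ^ 5 / E ^ 3 < 125 / 27 * (4 / 3 * pi / \<epsilon>)\<^sup>2" .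
  qed
  then obtain a where a: "fd_ratio \<epsilon> a = \<rho> ^ 5 / E ^ 3" by blast
  define K J where "K = fd_mass \<epsilon> a" and "J = fd_energy \<epsilon> a"
  have KJ: "0 < K" "0 < J" using fd_moments_pos[OF \<epsilon>] by (auto simp: K_def J_def)
  define s where "s = root 3 (\<rho> / K)"
  have s: "0 < s" "s ^ 3 * K = \<rho>" using \<rho> KJ by (auto simp: s_def)
  have sE: "s ^ 5 * J = E"
  proof -
    have "(s ^ 5) ^ 3 = (s ^ 3) ^ 5" by (simp flip: power_mult)
    then have "(s ^ 5 * J) ^ 3 = (s ^ 3 * K) ^ 5 * (J ^ 3 / K ^ 5)"
      unfolding power_mult_distrib using KJ by simp
    also have "J ^ 3 / K ^ 5 = inverse (fd_ratio \<epsilon> a)"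
      by (simp only: fd_ratio_def K_def J_def inverse_divide)
    also have "\<dots> = E ^ 3 / \<rho> ^ 5" by (simp only: a inverse_divide)
    also have "(s ^ 3 * K) ^ 5 * (E ^ 3 / \<rho> ^ 5) = E ^ 3" unfolding s(2) using \<rho> by simp
    finally have "(s ^ 5 * J) ^ 3 = E ^ 3" .
    then show ?thesis by (rule power_eq_imp_eq_base) (use s(1) KJ E in auto)
  qed
  let ?M = "fd_state \<epsilon> a u s"
  note M = fd_state_moments[OF \<epsilon> s(1), of a u]
  have m0: "(LINT v|lebesgue. ?M v) = (LINT v|lebesgue. f v)"
    using M(2) s(2) unfolding K_def \<rho>_def mass_def by (rule trans)
  have m1: "(LINT v|lebesgue. ?M v *\<^sub>R v) = (LINT v|lebesgue. f v *\<^sub>R v)"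
    unfolding M(3) m0 mom by (simp add: \<rho>_def mass_def)
  have "(LINT v|lebesgue. ?M v * (norm (v - u))\<^sup>2) = E" using M(4) sE unfolding J_def by (rule trans)
  then have m2: "(LINT v|lebesgue. ?M v * (norm v)\<^sup>2) = (LINT v|lebesgue. f v * (norm v)\<^sup>2)"
    unfolding E_def second_moment_about(2)[OF M(1)] second_moment_about(2)[OF f(1)] m0 m1 by linarith
  have "?M \<in> fermi_dirac \<epsilon>" using s(1) unfolding fermi_dirac_iff by blast
  with m0 m1 m2 show ?thesis unfolding same_moments_def by blast
qed

lemma equilibrium_spec:
  assumes "0 \<le> \<epsilon>" "f \<in> L1_2" "AE v in lebesgue. 0 \<le> f v" "\<not> (AE v in lebesgue. f v = 0)"
    and "0 < \<epsilon> \<Longrightarrow> 2 / 5 < temperature_ratio \<epsilon> f"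
  shows "equilibrium \<epsilon> f \<in> fermi_dirac \<epsilon>" "same_moments (equilibrium \<epsilon> f) f"
proof -
  obtain M where M: "M \<in> fermi_dirac \<epsilon>" "same_moments M f" using fermi_dirac_exists[OF assms] by blast
  have "equilibrium \<epsilon> f = (THE M. M \<in> fermi_dirac \<epsilon> \<and> same_moments M f)"
    by (simp add: equilibrium_def same_moments_def)
  also have "\<dots> = M"
    using M fermi_dirac_unique[OF assms(1)] by (intro the_equality) (auto simp: same_moments_def)
  finally show "equilibrium \<epsilon> f \<in> fermi_dirac \<epsilon>" "same_moments (equilibrium \<epsilon> f) f" using M by auto
qed

section \<open>Relative entropy as an integrated Bregman distance\<close>

text \<open>A bounded density with finite energy has finite entropy: its entropy density is controlled by the energy
  density and a Gaussian (\<open>abs_entropy_le\<close>).\<close>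

lemma integrable_entropy_bounded:
  assumes f: "f \<in> L1_2" "AE v in lebesgue. 0 \<le> f v" "AE v in lebesgue. f v \<le> C" and C: "0 < C"
  shows "integrable lebesgue (\<lambda>v. f v * ln (f v))"
proof -
  have [measurable]: "f \<in> borel_measurable lebesgue" using f(1) by (simp add: L1_2_def)
  \<comment> \<open>Normalise to a density below \<open>1\<close>, whose entropy density has a sign.\<close>
  have "integrable lebesgue (\<lambda>v. f v / C * ln (f v / C))"
  proof (rule Bochner_Integration.integrable_bound)
    show "integrable lebesgue (\<lambda>v. (f v * (norm v)\<^sup>2) / C + exp (- (norm v)\<^sup>2))"
      using L1_2D(3)[OF f(1)] integrable_gaussian[of 1, where 'a = velocity] by auto
    show "AE v in lebesgue. norm (f v / C * ln (f v / C)) \<le> norm ((f v * (norm v)\<^sup>2) / C + exp (- (norm v)\<^sup>2))"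
      using f(2,3)
    proof eventually_elim
      case (elim v)
      then have "\<bar>f v / C * ln (f v / C)\<bar> \<le> f v / C * (norm v)\<^sup>2 + exp (- (norm v)\<^sup>2)"
        using C by (intro abs_entropy_le) auto
      also have "\<dots> \<le> \<bar>(f v * (norm v)\<^sup>2) / C + exp (- (norm v)\<^sup>2)\<bar>" by simp
      finally show ?case by simp
    qed
  qed measurable
  then have "integrable lebesgue (\<lambda>v. C * (f v / C * ln (f v / C)) + ln C * f v)"
    using L1_2D(1)[OF f(1)] by (intro Bochner_Integration.integrable_add integrable_mult_right)
  moreover have "AE v in lebesgue. C * (f v / C * ln (f v / C)) + ln C * f v = f v * ln (f v)"
    using f(2)
  proof eventually_elim
    case (elim v)
    then show ?case using C by (cases "f v = 0") (auto simp: ln_div algebra_simps)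
  qed
  moreover have "(\<lambda>v. f v * ln (f v)) \<in> borel_measurable lebesgue" by measurable
  ultimately show ?thesis by (intro integrable_cong_AE_imp[of _ _ "\<lambda>v. f v * ln (f v)"])
qed

lemma integrable_Phi_closed:
  assumes \<epsilon>: "0 \<le> \<epsilon>" and f: "f \<in> L1_2" "AE v in lebesgue. 0 \<le> f v" "AE v in lebesgue. 0 \<le> 1 - \<epsilon> * f v"
    and ent: "integrable lebesgue (\<lambda>v. f v * ln (f v))"
  shows "integrable lebesgue (\<lambda>v. Phi_closed \<epsilon> (f v))"
    and "entropy \<epsilon> f = (LINT v|lebesgue. Phi_closed \<epsilon> (f v))"
proof -
  have [measurable]: "f \<in> borel_measurable lebesgue" using f(1) by (simp add: L1_2_def)
  show "integrable lebesgue (\<lambda>v. Phi_closed \<epsilon> (f v))"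
  proof (rule Bochner_Integration.integrable_bound)
    show "integrable lebesgue (\<lambda>v. \<bar>f v * ln (f v)\<bar> + \<bar>f v\<bar>)" using ent L1_2D(1)[OF f(1)] by auto
    show "AE v in lebesgue. norm (Phi_closed \<epsilon> (f v)) \<le> norm (\<bar>f v * ln (f v)\<bar> + \<bar>f v\<bar>)"
      using f(2,3) by eventually_elim (use abs_Phi_closed_le[OF \<epsilon>] in fastforce)
  qed measurable
  have ae: "AE v in lebesgue. Phi \<epsilon> (f v) = Phi_closed \<epsilon> (f v)"
    using f(2,3) by eventually_elim (rule Phi_eq_closed[OF \<epsilon>])
  show "entropy \<epsilon> f = (LINT v|lebesgue. Phi_closed \<epsilon> (f v))"
    unfolding entropy_def
    by (rule integral_cong_AE[OF borel_measurable_lebesgue_AE[OF _ ae] _ ae]) measurable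
qed

text \<open>The linear term of the Bregman distance integrates to zero by \<open>fermi_dirac_orthogonal\<close>.\<close>

lemma relative_entropy_eq_bregman:
  assumes \<epsilon>: "0 \<le> \<epsilon>" and f: "f \<in> L1_2" "AE v in lebesgue. 0 \<le> f v" "AE v in lebesgue. 0 \<le> 1 - \<epsilon> * f v"
    and ent: "integrable lebesgue (\<lambda>v. f v * ln (f v))"
    and M: "M \<in> fermi_dirac \<epsilon>" "same_moments M f"
  shows "integrable lebesgue (\<lambda>v. bregman \<epsilon> (f v) (M v))"
    and "relative_entropy \<epsilon> f M = (LINT v|lebesgue. bregman \<epsilon> (f v) (M v))"
proof -
  note M_L1_2 = fermi_dirac_L1_2[OF \<epsilon> M(1)]
  have "AE v in lebesgue. 0 \<le> M v" "AE v in lebesgue. 0 \<le> 1 - \<epsilon> * M v"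
    using fermi_dirac_bounds[OF \<epsilon> M(1)] by (auto intro: less_imp_le)
  moreover have "integrable lebesgue (\<lambda>v. M v * ln (M v))"
  proof -
    obtain a u s where "M = fd_state \<epsilon> a u s" using M(1) by (auto simp: fermi_dirac_iff)
    then have "M v \<le> exp a" for v
      using fd_bounds(2)[OF \<epsilon>, of a "(norm ((v - u) /\<^sub>R s))\<^sup>2"]
      by (auto simp: fd_state_def intro: order_trans simp del: norm_scaleR)
    then show ?thesis
      using M_L1_2 fermi_dirac_bounds(1)[OF \<epsilon> M(1)]
      by (intro integrable_entropy_bounded[where C = "exp a"]) (auto intro: less_imp_le)
  qed
  ultimately have M': "integrable lebesgue (\<lambda>v. Phi_closed \<epsilon> (M v))"
      "entropy \<epsilon> M = (LINT v|lebesgue. Phi_closed \<epsilon> (M v))"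
    using integrable_Phi_closed[OF \<epsilon> M_L1_2] by auto
  have "same_moments f M" using M(2) by (simp add: same_moments_def)
  note orth = fermi_dirac_orthogonal[OF \<epsilon> M(1) f(1) M_L1_2 this]
  note f' = integrable_Phi_closed[OF \<epsilon> f ent]
  show "integrable lebesgue (\<lambda>v. bregman \<epsilon> (f v) (M v))"
    unfolding bregman_def using f' M' orth by auto
  show "relative_entropy \<epsilon> f M = (LINT v|lebesgue. bregman \<epsilon> (f v) (M v))"
    unfolding bregman_def relative_entropy_def using f' M' orth by simp
qed

section \<open>The weighted inequality\<close>

lemma weighted_am_gm_powr:
  fixes a b \<theta> :: real assumes "0 < \<theta>" "\<theta> < 1" "0 \<le> a" "0 \<le> b"
  shows "a powr \<theta> * b powr (1 - \<theta>) \<le> \<theta> * a + (1 - \<theta>) * b"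
proof (cases "a = 0 \<or> b = 0")
  case False
  then show ?thesis using Youngs_inequality_0[of \<theta> "1-\<theta>" a b] assms by auto
qed (use assms in auto)

text \<open>Weighted arithmetic-geometric mean inequality for the two functions after division by their integrals; when
  an integral is zero, both sides are zero.\<close>

lemma holder_two_powers:
  fixes D Z :: "'a \<Rightarrow> real" and \<theta> :: real
  assumes \<theta>: "0 < \<theta>" "\<theta> < 1" and D: "integrable M D" "AE x in M. 0 \<le> D x"
    and Z: "integrable M Z" "AE x in M. 0 \<le> Z x"
  shows "integrable M (\<lambda>x. D x powr \<theta> * Z x powr (1 - \<theta>))"
    and "(LINT x|M. D x powr \<theta> * Z x powr (1 - \<theta>)) \<le> (LINT x|M. D x) powr \<theta> * (LINT x|M. Z x) powr (1 - \<theta>)"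
proof -
  have [measurable]: "D \<in> borel_measurable M" "Z \<in> borel_measurable M" using D Z by auto
  have young: "AE x in M. D x powr \<theta> * Z x powr (1 - \<theta>) \<le> \<theta> * D x + (1 - \<theta>) * Z x"
    using D(2) Z(2) by eventually_elim (rule weighted_am_gm_powr[OF \<theta>])
  have sum: "integrable M (\<lambda>x. \<theta> * D x + (1 - \<theta>) * Z x)" using D Z by simp
  show int: "integrable M (\<lambda>x. D x powr \<theta> * Z x powr (1 - \<theta>))"
    by (rule Bochner_Integration.integrable_bound[OF sum], measurable)
       (use young in eventually_elim, auto)
  define d z where "d = (LINT x|M. D x)" and "z = (LINT x|M. Z x)"
  have nn: "0 \<le> d" "0 \<le> z" using D Z by (auto simp: d_def z_def intro: integral_nonneg_AE)
  consider "d = 0" | "z = 0" | "0 < d" "0 < z" using nn by linarith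
  then show "(LINT x|M. D x powr \<theta> * Z x powr (1 - \<theta>)) \<le> (LINT x|M. D x) powr \<theta> * (LINT x|M. Z x) powr (1 - \<theta>)"
  proof cases
    case 1
    then have "AE x in M. D x = 0" using integral_nonneg_eq_0_iff_AE[OF D] by (simp add: d_def)
    then have "(LINT x|M. D x powr \<theta> * Z x powr (1 - \<theta>)) = (LINT x|M. 0)"
      by (intro integral_cong_AE) auto
    then show ?thesis by simp
  next
    case 2
    then have "AE x in M. Z x = 0" using integral_nonneg_eq_0_iff_AE[OF Z] by (simp add: z_def)
    then have "(LINT x|M. D x powr \<theta> * Z x powr (1 - \<theta>)) = (LINT x|M. 0)"
      by (intro integral_cong_AE) auto
    then show ?thesis by simp
  next
    case 3
    have "AE x in M. D x powr \<theta> * Z x powr (1 - \<theta>)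
        \<le> d powr \<theta> * z powr (1 - \<theta>) * (\<theta> * (D x / d) + (1 - \<theta>) * (Z x / z))"
      using D(2) Z(2)
    proof eventually_elim
      case (elim x)
      have "D x powr \<theta> * Z x powr (1 - \<theta>)
          = d powr \<theta> * z powr (1 - \<theta>) * ((D x / d) powr \<theta> * (Z x / z) powr (1 - \<theta>))"
        using elim 3 by (simp add: powr_divide)
      also have "\<dots> \<le> d powr \<theta> * z powr (1 - \<theta>) * (\<theta> * (D x / d) + (1 - \<theta>) * (Z x / z))"
        using elim 3 \<theta> by (intro mult_left_mono weighted_am_gm_powr) auto
      finally show ?case .
    qed
    then have "(LINT x|M. D x powr \<theta> * Z x powr (1 - \<theta>))
        \<le> (LINT x|M. d powr \<theta> * z powr (1 - \<theta>) * (\<theta> * (D x / d) + (1 - \<theta>) * (Z x / z)))"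
      using int D Z by (intro integral_mono_AE) auto
    also have "\<dots> = d powr \<theta> * z powr (1 - \<theta>) * (\<theta> * (d / d) + (1 - \<theta>) * (z / z))"
      using D Z by (simp add: d_def z_def)
    also have "\<dots> = d powr \<theta> * z powr (1 - \<theta>)" using 3 by simp
    finally show ?thesis by (simp add: d_def z_def)
  qed
qed

text \<open>Convexity of the power at the mean with weights \<open>1/3\<close> and \<open>2/3\<close>; the factor \<open>2\<close> is the sum of the
  coefficients \<open>2/3\<close> and \<open>4/3\<close>.\<close>

lemma powr_weighted_mean_le:
  fixes x y p :: real
  assumes "1 \<le> p" "0 \<le> x" "0 \<le> y"
  shows "(2/3 * x + 4/3 * y) powr p \<le> 2 powr p * (1/3 * x powr p + 2/3 * y powr p)"
proof -
  have conv: "(1/3 * x + 2/3 * y) powr p \<le> 1/3 * x powr p + 2/3 * y powr p"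
  proof (cases "x = 0 \<or> y = 0")
    case True
    have "(t * z) powr p \<le> t * z powr p" if "0 \<le> z" "0 < t" "t < 1" for t z :: real
    proof -
      have "t powr p \<le> t powr 1" using that assms by (intro powr_mono') auto
      then show ?thesis using that by (simp add: powr_mult mult_right_mono)
    qed
    from this[of y "2/3"] this[of x "1/3"] True assms show ?thesis by auto
  next
    case False
    with assms have "x \<in> {0<..}" "y \<in> {0<..}" by auto
    from convex_onD[OF powr_convex[OF assms(1)], of "2/3" x y] this show ?thesis by simp
  qed
  have "(2/3 * x + 4/3 * y) powr p = 2 powr p * (1/3 * x + 2/3 * y) powr p"
    using assms by (subst powr_mult[symmetric]) (auto simp: algebra_simps)
  with conv show ?thesis by simp
qed

lemma AE_le_Lp_norm_infinity:
  assumes "in_Lp \<infinity> g"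
  shows "AE v in lebesgue. \<bar>g v\<bar> \<le> Lp_norm \<infinity> g"
proof -
  define S where "S = esssup lebesgue (\<lambda>v. ereal \<bar>g v\<bar>)"
  have S: "AE v in lebesgue. ereal \<bar>g v\<bar> \<le> S" unfolding S_def by (rule esssup_AE)
  have "S \<noteq> -\<infinity>"
  proof
    assume "S = -\<infinity>"
    with S have "AE v::velocity in lebesgue. False" by simp
    then show False using not_AE_lebesgue_False by blast
  qed
  moreover have "S < \<infinity>" using assms by (simp add: in_Lp_def S_def)
  ultimately have "S = ereal (Lp_norm \<infinity> g)"
    unfolding Lp_norm_def S_def[symmetric] by (cases S) auto
  with S show ?thesis by simp
qed

text \<open>Multiplying the quadratic bound by \<open>w\<^sup>2\<close> gives \<open>((f - M) * w)\<^sup>2 \<le> D * Y\<close>, where \<open>Y\<close> is twice a convex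
  combination of \<open>f * w\<^sup>2\<close> and \<open>M * w\<^sup>2\<close>. For \<open>r = 2\<close> the factor \<open>Y\<close> is bounded almost everywhere; for
  \<open>r < 2\<close> the two factors are separated by the inequality of Hoelder.\<close>

lemma weighted_Lp_bound:
  fixes f M D w :: "velocity \<Rightarrow> real"
  assumes r: "1 \<le> r" "r \<le> 2"
    and f: "AE v in lebesgue. 0 \<le> f v" and M: "AE v in lebesgue. 0 \<le> M v"
    and D: "integrable lebesgue D" "AE v in lebesgue. 0 \<le> D v"
    and quad: "AE v in lebesgue. (f v - M v)\<^sup>2 \<le> (2/3 * f v + 4/3 * M v) * D v"
    and L: "in_Lp (ennreal r) (\<lambda>v. (f v - M v) * w v)"
      "in_Lp (weight_exponent r) (\<lambda>v. M v * (w v)\<^sup>2)" "in_Lp (weight_exponent r) (\<lambda>v. f v * (w v)\<^sup>2)"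
  shows "(Lp_norm (ennreal r) (\<lambda>v. (f v - M v) * w v))\<^sup>2 \<le>
    2 * max (Lp_norm (weight_exponent r) (\<lambda>v. M v * (w v)\<^sup>2)) (Lp_norm (weight_exponent r) (\<lambda>v. f v * (w v)\<^sup>2))
      * (LINT v|lebesgue. D v)"
proof -
  define N m H where "N = (LINT v|lebesgue. \<bar>(f v - M v) * w v\<bar> powr r)"
    and "m = max (Lp_norm (weight_exponent r) (\<lambda>v. M v * (w v)\<^sup>2)) (Lp_norm (weight_exponent r) (\<lambda>v. f v * (w v)\<^sup>2))"
    and "H = (LINT v|lebesgue. D v)"
  define Y where "Y v = 2/3 * (f v * (w v)\<^sup>2) + 4/3 * (M v * (w v)\<^sup>2)" for v
  have N_int: "integrable lebesgue (\<lambda>v. \<bar>(f v - M v) * w v\<bar> powr r)"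
    using L(1) r by (simp add: in_Lp_def)
  have N_nn: "0 \<le> N" by (simp add: N_def)
  have H: "0 \<le> H" unfolding H_def using D(2) by (rule integral_nonneg_AE)
  have norm: "(Lp_norm (ennreal r) (\<lambda>v. (f v - M v) * w v))\<^sup>2 = N powr (2 / r)"
    using r by (simp add: Lp_norm_def N_def power2_eq_square flip: powr_add)
  have Y_nn: "AE v in lebesgue. 0 \<le> Y v" using f M by eventually_elim (simp add: Y_def)
  have sq: "AE v in lebesgue. ((f v - M v) * w v)\<^sup>2 \<le> D v * Y v"
    using quad
  proof eventually_elim
    case (elim v)
    then have "(f v - M v)\<^sup>2 * (w v)\<^sup>2 \<le> ((2/3 * f v + 4/3 * M v) * D v) * (w v)\<^sup>2"
      by (rule mult_right_mono) simp
    moreover have "((2/3 * f v + 4/3 * M v) * D v) * (w v)\<^sup>2 = D v * Y v"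
      by (simp add: Y_def algebra_simps)
    ultimately show ?case by (simp only: power_mult_distrib)
  qed
  have "N powr (2 / r) \<le> 2 * m * H"
  proof (cases "r = 2")
    case True
    have "AE v in lebesgue. \<bar>f v * (w v)\<^sup>2\<bar> \<le> Lp_norm \<infinity> (\<lambda>v. f v * (w v)\<^sup>2)"
         "AE v in lebesgue. \<bar>M v * (w v)\<^sup>2\<bar> \<le> Lp_norm \<infinity> (\<lambda>v. M v * (w v)\<^sup>2)"
      using L(2,3) True unfolding weight_exponent_def
      by (simp_all only: if_True AE_le_Lp_norm_infinity simp_thms)
    then have "AE v in lebesgue. Y v \<le> 2 * m"
      by eventually_elim (simp add: Y_def m_def True weight_exponent_def)
    with sq D(2) have "AE v in lebesgue. \<bar>(f v - M v) * w v\<bar> powr r \<le> 2 * m * D v"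
    proof eventually_elim
      case (elim v)
      have "((f v - M v) * w v)\<^sup>2 \<le> D v * (2 * m)"
        using elim by (meson order_trans mult_left_mono)
      then show ?case by (simp add: True mult.commute)
    qed
    then have "N \<le> (LINT v|lebesgue. 2 * m * D v)"
      unfolding N_def using N_int D(1) by (intro integral_mono_AE) auto
    then show ?thesis using True N_nn by (simp add: H_def)
  next
    case False
    with r have r2: "r < 2" by simp
    \<comment> \<open>Hoelder with weights \<open>\<theta>\<close> and \<open>1 - \<theta>\<close> splits \<open>(D * Y) powr \<theta>\<close>; the second factor is
      \<open>(Y powr p) powr (1 - \<theta>)\<close> precisely because \<open>p * (1 - \<theta>) = \<theta>\<close>.\<close>
    define p \<theta> where "p = r / (2 - r)" and "\<theta> = r / 2"
    have p: "1 \<le> p" using r r2 by (simp add: p_def)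
    have \<theta>: "0 < \<theta>" "\<theta> < 1" using r r2 by (auto simp: \<theta>_def)
    have p\<theta>: "p * (1 - \<theta>) = \<theta>" "(1 - \<theta>) / \<theta> = 1 / p" using r2 r by (auto simp: p_def \<theta>_def field_simps)
    have wexp: "weight_exponent r \<noteq> \<infinity>" "enn2real (weight_exponent r) = p"
      using False p by (auto simp: weight_exponent_def p_def)
    have F: "integrable lebesgue (\<lambda>v. \<bar>f v * (w v)\<^sup>2\<bar> powr p)" "(LINT v|lebesgue. \<bar>f v * (w v)\<^sup>2\<bar> powr p) \<le> m powr p"
      and G: "integrable lebesgue (\<lambda>v. \<bar>M v * (w v)\<^sup>2\<bar> powr p)" "(LINT v|lebesgue. \<bar>M v * (w v)\<^sup>2\<bar> powr p) \<le> m powr p"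
      and m: "0 \<le> m"
    proof -
      show "integrable lebesgue (\<lambda>v. \<bar>f v * (w v)\<^sup>2\<bar> powr p)" "integrable lebesgue (\<lambda>v. \<bar>M v * (w v)\<^sup>2\<bar> powr p)"
        using L(2,3) wexp by (auto simp: in_Lp_def)
      have norm_p: "0 \<le> Lp_norm (weight_exponent r) g"
        "(LINT v|lebesgue. \<bar>g v\<bar> powr p) = Lp_norm (weight_exponent r) g powr p" for g
        using wexp p by (auto simp: Lp_norm_def powr_powr)
      then show "0 \<le> m" by (simp add: m_def le_max_iff_disj)
      show "(LINT v|lebesgue. \<bar>f v * (w v)\<^sup>2\<bar> powr p) \<le> m powr p" "(LINT v|lebesgue. \<bar>M v * (w v)\<^sup>2\<bar> powr p) \<le> m powr p"
        unfolding norm_p(2) m_def using p norm_p(1) by (auto intro!: powr_mono2)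
    qed
    define Z where "Z v = 2 powr p * (1/3 * \<bar>f v * (w v)\<^sup>2\<bar> powr p + 2/3 * \<bar>M v * (w v)\<^sup>2\<bar> powr p)" for v
    have Z: "integrable lebesgue Z" "AE v in lebesgue. 0 \<le> Z v" unfolding Z_def using F G by auto
    have "(LINT v|lebesgue. Z v) \<le> 2 powr p * m powr p"
      unfolding Z_def using F G by simp
    also have "\<dots> = (2 * m) powr p" using m by (simp add: powr_mult)
    finally have Z_le: "(LINT v|lebesgue. Z v) \<le> (2 * m) powr p" .
    have "AE v in lebesgue. \<bar>(f v - M v) * w v\<bar> powr r \<le> D v powr \<theta> * Z v powr (1 - \<theta>)"
      using sq f M D(2) Y_nn
    proof eventually_elim
      case (elim v)
      have "Y v powr p \<le> Z v"
        unfolding Y_def Z_def using powr_weighted_mean_le[OF p, of "f v * (w v)\<^sup>2" "M v * (w v)\<^sup>2"] elim by simp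
      then have "(Y v powr p) powr (1 - \<theta>) \<le> Z v powr (1 - \<theta>)" using \<theta> by (intro powr_mono2) auto
      then have YZ: "Y v powr \<theta> \<le> Z v powr (1 - \<theta>)" by (simp add: powr_powr p\<theta>)
      have "\<bar>(f v - M v) * w v\<bar> powr r = (((f v - M v) * w v)\<^sup>2) powr \<theta>"
      proof -
        have "(((f v - M v) * w v)\<^sup>2) powr \<theta> = (\<bar>(f v - M v) * w v\<bar> powr 2) powr \<theta>" by simp
        then show ?thesis by (simp add: powr_powr \<theta>_def del: powr_numeral)
      qed
      also have "\<dots> \<le> (D v * Y v) powr \<theta>" using elim \<theta> by (intro powr_mono2) auto
      also have "\<dots> = D v powr \<theta> * Y v powr \<theta>" using elim by (simp add: powr_mult)
      also have "\<dots> \<le> D v powr \<theta> * Z v powr (1 - \<theta>)" using YZ by (intro mult_left_mono) auto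
      finally show ?case .
    qed
    then have "N \<le> (LINT v|lebesgue. D v powr \<theta> * Z v powr (1 - \<theta>))"
      unfolding N_def using N_int holder_two_powers(1)[OF \<theta> D Z] by (intro integral_mono_AE) auto
    also have "\<dots> \<le> H powr \<theta> * (LINT v|lebesgue. Z v) powr (1 - \<theta>)"
      unfolding H_def by (rule holder_two_powers(2)[OF \<theta> D Z])
    also have "\<dots> \<le> H powr \<theta> * ((2 * m) powr p) powr (1 - \<theta>)"
      using Z_le \<theta> integral_nonneg_AE[OF Z(2)] by (intro mult_left_mono powr_mono2) auto
    also have "\<dots> = (2 * m * H) powr \<theta>"
      using m H by (simp add: powr_powr p\<theta> powr_mult)
    finally have "N powr (1 / \<theta>) \<le> ((2 * m * H) powr \<theta>) powr (1 / \<theta>)"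
      using N_nn \<theta> by (intro powr_mono2) auto
    also have "\<dots> = 2 * m * H" using \<theta> m H by (simp add: powr_powr)
    finally show ?thesis by (simp add: \<theta>_def)
  qed
  then show ?thesis unfolding norm m_def H_def .
qed

lemma weighted_csiszar_kullback:
  assumes r: "1 \<le> r" "r \<le> 2" and \<epsilon>: "0 \<le> \<epsilon>"
    and f: "f \<in> L1_2" "AE v in lebesgue. 0 \<le> f v" "AE v in lebesgue. 0 \<le> 1 - \<epsilon> * f v"
    and ent: "integrable lebesgue (\<lambda>v. f v * ln (f v))"
    and M: "M \<in> fermi_dirac \<epsilon>" "same_moments M f"
    and L: "in_Lp (ennreal r) (\<lambda>v. (f v - M v) * w v)"
      "in_Lp (weight_exponent r) (\<lambda>v. M v * (w v)\<^sup>2)" "in_Lp (weight_exponent r) (\<lambda>v. f v * (w v)\<^sup>2)"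
  shows "(Lp_norm (ennreal r) (\<lambda>v. (f v - M v) * w v))\<^sup>2 \<le>
    2 * max (Lp_norm (weight_exponent r) (\<lambda>v. M v * (w v)\<^sup>2)) (Lp_norm (weight_exponent r) (\<lambda>v. f v * (w v)\<^sup>2))
      * relative_entropy \<epsilon> f M"
proof -
  note bounds = fermi_dirac_bounds[OF \<epsilon> M(1)]
  note breg = relative_entropy_eq_bregman[OF \<epsilon> f ent M]
  have "AE v in lebesgue. 0 \<le> bregman \<epsilon> (f v) (M v)"
    using f(2,3) by eventually_elim (use quadratic_le_bregman(1)[OF \<epsilon>] bounds in blast)
  moreover have "AE v in lebesgue. (f v - M v)\<^sup>2 \<le> (2/3 * f v + 4/3 * M v) * bregman \<epsilon> (f v) (M v)"
    using f(2,3) by eventually_elim (use quadratic_le_bregman(2)[OF \<epsilon>] bounds in blast)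
  moreover have "AE v in lebesgue. 0 \<le> M v" using bounds(1) by (auto intro: less_imp_le)
  ultimately show ?thesis
    unfolding breg(2) by (intro weighted_Lp_bound r f(2) breg(1) L)
qed

theorem proposition4:
  fixes w :: "real ^ 3 \<Rightarrow> real" and r :: real
  assumes "w \<in> borel_measurable lebesgue"
    and "\<And>v. 0 \<le> w v"
    and "1 \<le> r" and "r \<le> 2"
  shows "(\<forall>f. f \<in> L1_2 \<inter> LlogL \<longrightarrow>
            (AE v in lebesgue. 0 \<le> f v) \<longrightarrow>
            \<not> (AE v in lebesgue. f v = 0) \<longrightarrow>
            in_Lp (ennreal r) (\<lambda>v. (f v - maxwellian f v) * w v) \<longrightarrow>
            in_Lp (weight_exponent r) (\<lambda>v. maxwellian f v * (w v)\<^sup>2) \<longrightarrow>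
            in_Lp (weight_exponent r) (\<lambda>v. f v * (w v)\<^sup>2) \<longrightarrow>
            (Lp_norm (ennreal r) (\<lambda>v. (f v - maxwellian f v) * w v))\<^sup>2
              \<le> 2 * max (Lp_norm (weight_exponent r) (\<lambda>v. maxwellian f v * (w v)\<^sup>2))
                        (Lp_norm (weight_exponent r) (\<lambda>v. f v * (w v)\<^sup>2))
                  * relative_entropy 0 f (maxwellian f))
       \<and> (\<forall>\<epsilon> f. \<epsilon> > 0 \<longrightarrow> f \<in> L1_2 \<longrightarrow>
            (AE v in lebesgue. 0 \<le> f v) \<longrightarrow>
            \<not> (AE v in lebesgue. f v = 0) \<longrightarrow>
            (AE v in lebesgue. 1 - \<epsilon> * f v \<ge> 0) \<longrightarrow>
            temperature_ratio \<epsilon> f > 2 / 5 \<longrightarrow>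
            in_Lp (ennreal r) (\<lambda>v. (f v - equilibrium \<epsilon> f v) * w v) \<longrightarrow>
            in_Lp (weight_exponent r) (\<lambda>v. equilibrium \<epsilon> f v * (w v)\<^sup>2) \<longrightarrow>
            in_Lp (weight_exponent r) (\<lambda>v. f v * (w v)\<^sup>2) \<longrightarrow>
            (Lp_norm (ennreal r) (\<lambda>v. (f v - equilibrium \<epsilon> f v) * w v))\<^sup>2
              \<le> 2 * max (Lp_norm (weight_exponent r) (\<lambda>v. equilibrium \<epsilon> f v * (w v)\<^sup>2))
                        (Lp_norm (weight_exponent r) (\<lambda>v. f v * (w v)\<^sup>2))
                  * relative_entropy \<epsilon> f (equilibrium \<epsilon> f))"
proof (intro conjI allI impI)
  fix f
  assume f: "f \<in> L1_2 \<inter> LlogL" "AE v in lebesgue. 0 \<le> f v" "\<not> (AE v in lebesgue. f v = 0)"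
    and L: "in_Lp (ennreal r) (\<lambda>v. (f v - maxwellian f v) * w v)"
      "in_Lp (weight_exponent r) (\<lambda>v. maxwellian f v * (w v)\<^sup>2)"
      "in_Lp (weight_exponent r) (\<lambda>v. f v * (w v)\<^sup>2)"
  \<comment> \<open>The real logarithm is even by convention, so the absolute value may be dropped.\<close>
  have "integrable lebesgue (\<lambda>v. f v * ln (f v))"
    using f(1) by (simp add: LlogL_def abs_if ln_minus if_distrib cong: if_cong)
  with f L assms(3,4) equilibrium_spec[of 0 f]
  show "(Lp_norm (ennreal r) (\<lambda>v. (f v - maxwellian f v) * w v))\<^sup>2
              \<le> 2 * max (Lp_norm (weight_exponent r) (\<lambda>v. maxwellian f v * (w v)\<^sup>2))
                        (Lp_norm (weight_exponent r) (\<lambda>v. f v * (w v)\<^sup>2))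
                  * relative_entropy 0 f (maxwellian f)"
    by (intro weighted_csiszar_kullback) auto
next
  fix \<epsilon> f
  assume \<epsilon>: "0 < \<epsilon>"
    and f: "f \<in> L1_2" "AE v in lebesgue. 0 \<le> f v" "\<not> (AE v in lebesgue. f v = 0)"
      "AE v in lebesgue. 1 - \<epsilon> * f v \<ge> 0" "2 / 5 < temperature_ratio \<epsilon> f"
    and L: "in_Lp (ennreal r) (\<lambda>v. (f v - equilibrium \<epsilon> f v) * w v)"
      "in_Lp (weight_exponent r) (\<lambda>v. equilibrium \<epsilon> f v * (w v)\<^sup>2)"
      "in_Lp (weight_exponent r) (\<lambda>v. f v * (w v)\<^sup>2)"
  have "AE v in lebesgue. f v \<le> 1 / \<epsilon>" using f(4) by eventually_elim (use \<epsilon> in \<open>simp add: field_simps\<close>)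
  then have "integrable lebesgue (\<lambda>v. f v * ln (f v))"
    using f \<epsilon> by (intro integrable_entropy_bounded[where C = "1 / \<epsilon>"]) auto
  with f L \<epsilon> assms(3,4) equilibrium_spec[of \<epsilon> f]
  show "(Lp_norm (ennreal r) (\<lambda>v. (f v - equilibrium \<epsilon> f v) * w v))\<^sup>2
              \<le> 2 * max (Lp_norm (weight_exponent r) (\<lambda>v. equilibrium \<epsilon> f v * (w v)\<^sup>2))
                        (Lp_norm (weight_exponent r) (\<lambda>v. f v * (w v)\<^sup>2))
                  * relative_entropy \<epsilon> f (equilibrium \<epsilon> f)"
    by (intro weighted_csiszar_kullback) auto
qed

end
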